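(* Assume (A0)–(A7) listed in the context. The numerical discretisation (P) stated in the context can be realised as a decoupled scheme whose first step is linear and whose second step is, in general, nonlinear. That is, for each $0\le n\le n_T-1$ and given $(\phi_h^n,\mathbf u_h^n,\theta_h^n)\in\mathcal V_h\times\mathcal X_h^d\times\mathcal V_h$, solving the $n$-th step of (P) for $(\phi_h^{n+1},\mu_h^{n+1},\mathbf u_h^{n+1},\theta_h^{n+1},p_h^{n+1})$ is equivalent to performing successively: 1. (linear step) Find $(\mathbf u_h^{n+1},\theta_h^{n+1},p_h^{n+1})\in\mathcal X_h^d\times\mathcal V_h\times\mathcal V_h$ such that $$\langle\mathbf C_\nu(\phi_h^n)\mathcal E(d_\tau^{n+1}\mathbf u_h),\mathcal E(\mathbf v_h)\rangle+\langle\widetilde W_{\mathcal E(\mathbf u)}(\phi_h^n,\mathcal E(\mathbf u_h^{n+1}),\theta_h^{n+1}),\mathcal E(\mathbf v_h)\rangle=\langle\mathbf f^{n+1},\mathbf v_h\rangle,$$ $$\langle d_\tau^{n+1}\theta_h,\chi_h\rangle+\langle\kappa(\phi_h^n)\nabla p_h^{n+1},\nabla\chi_h\rangle=\langle s(\phi_h^n,\mathcal E(\mathbf u_h^n),\theta_h^n),\chi_h\rangle,$$ $$\langle p_h^{n+1},q_h\rangle-\langle\widetilde W_\theta(\phi_h^n,\mathcal E(\mathbf u_h^{n+1}),\theta_h^{n+1}),q_h\rangle=0$$ for all $(\mathbf v_h,\chi_h,q_h)\in\mathcal X_h^d\times\mathcal V_h\times\mathcal V_h$; this is a linear (inhomogeneous)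 system in the unknowns $(\mathbf u_h^{n+1},\theta_h^{n+1},p_h^{n+1})$. 2. (in general nonlinear step) With $(\mathbf u_h^{n+1},\theta_h^{n+1})$ from step 1, find $(\phi_h^{n+1},\mu_h^{n+1})\in\mathcal V_h\times\mathcal V_h$ such that $$\langle d_\tau^{n+1}\phi_h,\psi_h\rangle+\langle m(\phi_h^n)\nabla\mu_h^{n+1},\nabla\psi_h\rangle=\langle r(\phi_h^n,\mathcal E(\mathbf u_h^{n+1}),\theta_h^{n+1}),\psi_h\rangle,$$ $$\langle\mu_h^{n+1},\xi_h\rangle-\gamma\langle\nabla\phi_h^{n+1},\nabla\xi_h\rangle-\langle\Psi'(\phi_h^{n+1},\phi_h^n),\xi_h\rangle-\langle\widetilde W_\phi^{av}(\phi_h,\mathcal E(\mathbf u_h^{n+1}),\theta_h^{n+1}),\xi_h\rangle=0$$ for all $(\psi_h,\xi_h)\in\mathcal V_h\times\mathcal V_h$.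
   Context: **Notation.** $\langle\cdot,\cdot\rangle$ is the $L^2(\Omega)$-inner product (for scalar, vector and matrix functions), and also denotes the duality pairing when $\mathbf f$ is involved. $\mathcal E(\mathbf u)=\frac12(\nabla\mathbf u+\nabla\mathbf u^\top)$ is the symmetric gradient. $\mathbf I$ is the identity matrix. The reduced energy density is $$\widetilde W(\phi,\mathcal E(\mathbf u),\theta)=W(\phi,\mathcal E(\mathbf u))+\tfrac{M(\phi)}2\big(\theta-\alpha(\phi)\,\mathrm{tr}(\mathcal E(\mathbf u))\big)^2,$$ with partial derivatives $\widetilde W_\phi,\widetilde W_{\mathcal E(\mathbf u)},\widetilde W_\theta$. **Assumptions.** - (A0) $\Omega\subset\mathbb R^d$, $d\in\{2,3\}$, is a bounded Lipschitz domain; the boundary conditions on $\partial\Omega$ are $\mathbf u=\mathbf 0$ and $\kappa(\phi)\nabla p\cdot\mathbf n=\nabla\phi\cdot\mathbf n=m(\phi)\nabla\mu\cdot\mathbf n=0$ (incorporated in the discrete problem through the choice of spaces and the weak form). - (A1) $\gamma>0$ is a constant. - (A2) $\Psi\in C^2(\mathbb R)$ is bounded from below and $\Psi=\Psi_{\rm vex}+\Psi_{\rm cav}$ with $\Psi_{\rm vex}$ convex and $\Psi_{\rm cav}$ concave (both differentiable); $|\Psi(x)|\le c_1|x|^{q}+c_2$ for some $q\le6$ and constants $c_1,c_2\ge0$. - (A3) $W(x,\mathcal G)=(\mathcal G-\mathcal T(x)):\mathbf C(x):(\mathcal G-\mathcal T(x))$ for $x\in\mathbb R$, $\mathcal G\in\mathbb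 R^{d\times d}$, with symmetric eigenstrain $\mathcal T\in C^2(\mathbb R)$ (matrix valued) and symmetric elastic (fourth-order) tensor $\mathbf C\in C^2(\mathbb R)$ such that for some $c>0$, $\mathcal G:\mathbf C(x):\mathcal G\ge c|\mathcal G|^2$ and $\mathcal D:\mathbf C(x):\mathcal G=\mathcal D:\mathbf C(x)\mathcal G=\mathbf C(x)\mathcal D:\mathcal G$ for all $x\in\mathbb R$ and $\mathcal D,\mathcal G\in\mathbb R^{d\times d}_{\rm sym}$. Moreover $\mathcal T(x)=\xi(x-a)\mathbf I$ for constants $\xi,a$, and all derivatives of $\mathbf C$ are uniformly bounded from above and below. - (A4) $\mathbf C_\nu$ fulfils the same assumptions as $\mathbf C$. - (A5) There are positive constants with $m_0\le m(x)\le m_1$ and $\kappa_0\le\kappa(x)\le\kappa_1$ for all $x\in\mathbb R$. - (A6) There are positive constants with $M_0\le M(x)\le M_1$, $\alpha_0\le\alpha(x)\le\alpha_1$ for all $x\in\mathbb R$; $M,\alpha$ are sufficiently regular with $|\alpha^{(k)}(x)|\le\alpha_{k+1}$, $|M^{(k)}(x)|\le M_{k+1}$, $k\in\{1,2\}$, $x\in\mathbb R$. - (A7) $\mathbf f\in L^2(0,T;H^{-1}(\Omega)^d)$; $r,s\in C^1(\mathbb R\times\mathbb R^{d\times d}\times\mathbb R)$ are uniformly bounded. **Discretisation.** $\mathcal T_h$ is a geometrically conforming partition of $\Omega$ into simplices; $\mathcal V_h=\{v\in H^1(\Omega)\cap C^0(\overline\Omega): v|_K\in P_1(K)\ \forall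 K\in\mathcal T_h\}$ and $\mathcal X_h=\{v\in\mathcal V_h: v|_{\partial\Omega}=0\}$. The interval $[0,T]$ is divided uniformly: $\mathcal I_\tau=\{0=t^0,t^1=\tau,\dots,t^{n_T}=T\}$, $\tau>0$, $n_T=T/\tau$, $I_n=(t^n,t^{n+1})$. $\Pi^1_c(\mathcal I_\tau;X)$ and $\Pi^0(\mathcal I_\tau;X)$ are the continuous piecewise linear and the piecewise constant functions on $\mathcal I_\tau$ with values in $X$. Superscripts $g^n,g^{n+1}$ denote evaluation/approximation at $t^n,t^{n+1}$; a function in $\Pi^0$ has the value $g^{n+1}$ on $I_n$; $\mathbf f^{n+1}\in H^{-1}(\Omega)^d$ is the evaluation/approximation of $\mathbf f$ at $t^{n+1}$. Further, $d^{n+1}_\tau g=(g^{n+1}-g^n)/\tau$, $\Psi'(\phi_h^{n+1},\phi_h^n):=\Psi'_{\rm vex}(\phi_h^{n+1})+\Psi'_{\rm cav}(\phi_h^n)$, and $$\widetilde W_\phi^{av}(\phi_h,\mathcal E(\mathbf u_h^{n+1}),\theta_h^{n+1}):=\frac1\tau\int_{I_n}\widetilde W_\phi(\phi_h(t),\mathcal E(\mathbf u_h^{n+1}),\theta_h^{n+1})\,\mathrm dt,$$ where $\phi_h$ is the linear interpolant in time of $\phi_h^n,\phi_h^{n+1}$ on $I_n$. **Problem (P).** Given $(\phi_{h,0},\mathbf u_{h,0},\theta_{h,0})\in\mathcal V_h\times\mathcal X_h^d\times\mathcal V_h$, find $(\phi_h,\mathbf u_h,\theta_h)\in\Pi^1_c(\mathcal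 I_\tau;\mathcal V_h\times\mathcal X_h^d\times\mathcal V_h)$ with these initial values and $(\mu_h,p_h)\in\Pi^0(\mathcal I_\tau;\mathcal V_h\times\mathcal V_h)$ such that $$\langle d_\tau^{n+1}\phi_h,\psi_h\rangle+\langle m(\phi_h^n)\nabla\mu_h^{n+1},\nabla\psi_h\rangle=\langle r(\phi_h^n,\mathcal E(\mathbf u_h^{n+1}),\theta_h^{n+1}),\psi_h\rangle,$$ $$\langle\mu_h^{n+1},\xi_h\rangle-\gamma\langle\nabla\phi_h^{n+1},\nabla\xi_h\rangle-\langle\Psi'(\phi_h^{n+1},\phi_h^n)+\widetilde W_\phi^{av}(\phi_h,\mathcal E(\mathbf u_h^{n+1}),\theta_h^{n+1}),\xi_h\rangle=0,$$ $$\langle\mathbf C_\nu(\phi_h^n)\mathcal E(d_\tau^{n+1}\mathbf u_h),\mathcal E(\mathbf v_h)\rangle+\langle\widetilde W_{\mathcal E(\mathbf u)}(\phi_h^n,\mathcal E(\mathbf u_h^{n+1}),\theta_h^{n+1}),\mathcal E(\mathbf v_h)\rangle=\langle\mathbf f^{n+1},\mathbf v_h\rangle,$$ $$\langle d_\tau^{n+1}\theta_h,\chi_h\rangle+\langle\kappa(\phi_h^n)\nabla p_h^{n+1},\nabla\chi_h\rangle=\langle s(\phi_h^n,\mathcal E(\mathbf u_h^n),\theta_h^n),\chi_h\rangle,$$ $$\langle p_h^{n+1},q_h\rangle-\langle\widetilde W_\theta(\phi_h^n,\mathcal E(\mathbf u_h^{n+1}),\theta_h^{n+1}),q_h\rangle=0$$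 for all $(\psi_h,\xi_h,\mathbf v_h,\chi_h,q_h)\in\mathcal V_h\times\mathcal V_h\times\mathcal X_h^d\times\mathcal V_h\times\mathcal V_h$ and all $0\le n\le n_T-1$. The "$n$-th step of (P)" means these five equations for that fixed $n$. *)

theory Defs
  imports "HOL-Analysis.Analysis" "HOL-Library.Function_Algebras"
begin

section \<open>Preliminaries\<close>

instantiation "fun" :: (type, real_vector) real_vector
begin

definition scaleR_fun :: "real \<Rightarrow> ('a \<Rightarrow> 'b) \<Rightarrow> 'a \<Rightarrow> 'b" where
  "scaleR_fun c f = (\<lambda>x. c *\<^sub>R f x)"

instance
  by standard (simp_all add: scaleR_fun_def fun_eq_iff scaleR_add_right scaleR_add_left)

end

text \<open>A family of equations \<open>R z t = 0\<close>, indexed by \<open>t \<in> S\<close>, for an unknown \<open>z\<close> in the linear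
  space \<open>Z\<close> is a linear (inhomogeneous) system if \<open>R z t = A z t - b t\<close> with \<open>A\<close> linear
  in \<open>z\<close> and \<open>b\<close> independent of \<open>z\<close>.\<close>

definition linear_system ::
  "'z::real_vector set \<Rightarrow> 't set \<Rightarrow> ('z \<Rightarrow> 't \<Rightarrow> 'r::real_vector) \<Rightarrow> bool" where
  "linear_system Z S R \<longleftrightarrow>
     (\<exists>A b. (\<forall>z\<in>Z. \<forall>t\<in>S. R z t = A z t - b t) \<and>
            (\<forall>z\<in>Z. \<forall>z'\<in>Z. \<forall>a c. \<forall>t\<in>S.
               A (a *\<^sub>R z + c *\<^sub>R z') t = a *\<^sub>R A z t + c *\<^sub>R A z' t))"

text \<open>Classical gradient; on matrices it is taken with respect to the Frobenius inner product.\<close>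

definition gradient :: "('a::real_inner \<Rightarrow> real) \<Rightarrow> 'a \<Rightarrow> 'a" where
  "gradient f x = (THE D. GDERIV f x :> D)"

definition vderiv :: "(real \<Rightarrow> 'a::real_normed_vector) \<Rightarrow> real \<Rightarrow> 'a" where
  "vderiv f = (\<lambda>x. vector_derivative f (at x))"

definition C2_fun :: "(real \<Rightarrow> 'a::real_normed_vector) \<Rightarrow> bool" where
  "C2_fun f \<longleftrightarrow> f C1_differentiable_on UNIV \<and> vderiv f C1_differentiable_on UNIV"

definition C1_map :: "('a::real_normed_vector \<Rightarrow> real) \<Rightarrow> bool" where
  "C1_map f \<longleftrightarrow>
     (\<exists>D :: 'a \<Rightarrow> 'a \<Rightarrow>\<^sub>L real. continuous_on UNIV D \<and>
        (\<forall>z. (f has_derivative blinfun_apply (D z)) (at z)))"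


section \<open>Domain and Sobolev spaces\<close>

text \<open>Near each boundary point, \<open>\<Omega>\<close> lies strictly below the graph of a Lipschitz function over
  the hyperplane orthogonal to a unit vector \<open>e\<close>; \<open>x - (x \<bullet> e) *\<^sub>R e\<close> is the projection
  of \<open>x\<close> onto that hyperplane.\<close>

definition bounded_lipschitz_domain :: "'a::euclidean_space set \<Rightarrow> bool" where
  "bounded_lipschitz_domain \<Omega> \<longleftrightarrow>
     open \<Omega> \<and> connected \<Omega> \<and> \<Omega> \<noteq> {} \<and> bounded \<Omega> \<and>
     (\<forall>x0\<in>frontier \<Omega>. \<exists>\<rho>>0. \<exists>e g L. norm e = 1 \<and> L-lipschitz_on {y. y \<bullet> e = 0} g \<and>
        \<Omega> \<inter> ball x0 \<rho> = {x \<in> ball x0 \<rho>. x \<bullet> e < (g (x - (x \<bullet> e) *\<^sub>R e) :: real)})"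

text \<open>Functions on \<open>\<Omega>\<close> or its closure are total functions of which only the values on the
  closure are used.\<close>

definition L2 :: "'a::euclidean_space set \<Rightarrow> ('a \<Rightarrow> 'b::real_inner) set" where
  "L2 \<Omega> = {f. f \<in> borel_measurable (lebesgue_on \<Omega>) \<and>
                integrable (lebesgue_on \<Omega>) (\<lambda>x. (norm (f x))\<^sup>2)}"

definition L2_inner ::
  "'a::euclidean_space set \<Rightarrow> ('a \<Rightarrow> 'b::real_inner) \<Rightarrow> ('a \<Rightarrow> 'b) \<Rightarrow> real" where
  "L2_inner \<Omega> f g = integral\<^sup>L (lebesgue_on \<Omega>) (\<lambda>x. f x \<bullet> g x)"

text \<open>\<open>C\<^sup>1\<close> functions with compact support in \<open>\<Omega>\<close>. As test functions they give the same weak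
  derivatives, and the same closure in \<open>H\<^sup>1\<close>, as the smooth compactly supported functions.\<close>

definition C1c :: "'a::euclidean_space set \<Rightarrow> ('a \<Rightarrow> real) set" where
  "C1c \<Omega> = {\<eta>. (\<exists>K. compact K \<and> K \<subseteq> \<Omega> \<and> (\<forall>x. x \<notin> K \<longrightarrow> \<eta> x = 0)) \<and>
                 (\<exists>G. continuous_on UNIV G \<and> (\<forall>x. GDERIV \<eta> x :> G x))}"

definition weak_gradient ::
  "'a::euclidean_space set \<Rightarrow> ('a \<Rightarrow> real) \<Rightarrow> ('a \<Rightarrow> 'a) \<Rightarrow> bool" where
  "weak_gradient \<Omega> v g \<longleftrightarrow> g \<in> L2 \<Omega> \<and>
     (\<forall>\<eta>\<in>C1c \<Omega>. integral\<^sup>L (lebesgue_on \<Omega>) (\<lambda>x. v x *\<^sub>R gradient \<eta> x) =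
                 - integral\<^sup>L (lebesgue_on \<Omega>) (\<lambda>x. \<eta> x *\<^sub>R g x))"

definition H1 :: "'a::euclidean_space set \<Rightarrow> ('a \<Rightarrow> real) set" where
  "H1 \<Omega> = {v \<in> L2 \<Omega>. \<exists>g. weak_gradient \<Omega> v g}"

text \<open>A representative of the weak gradient, which is unique almost everywhere.\<close>

definition grad :: "'a::euclidean_space set \<Rightarrow> ('a \<Rightarrow> real) \<Rightarrow> 'a \<Rightarrow> 'a" where
  "grad \<Omega> v = (SOME g. weak_gradient \<Omega> v g)"

definition jacobian ::
  "(real^'d) set \<Rightarrow> (real^'d \<Rightarrow> real^'d) \<Rightarrow> real^'d \<Rightarrow> real^'d^'d" where
  "jacobian \<Omega> u x = (\<chi> i. grad \<Omega> (\<lambda>y. u y $ i) x)"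

definition symgrad ::
  "(real^'d) set \<Rightarrow> (real^'d \<Rightarrow> real^'d) \<Rightarrow> real^'d \<Rightarrow> real^'d^'d" where
  "symgrad \<Omega> u x = (1/2) *\<^sub>R (jacobian \<Omega> u x + transpose (jacobian \<Omega> u x))"

definition H1_norm :: "'a::euclidean_space set \<Rightarrow> ('a \<Rightarrow> real) \<Rightarrow> real" where
  "H1_norm \<Omega> v = sqrt (L2_inner \<Omega> v v + L2_inner \<Omega> (grad \<Omega> v) (grad \<Omega> v))"

definition H10 :: "'a::euclidean_space set \<Rightarrow> ('a \<Rightarrow> real) set" where
  "H10 \<Omega> = {v \<in> H1 \<Omega>. \<forall>\<epsilon>>0. \<exists>\<eta>\<in>C1c \<Omega>. H1_norm \<Omega> (\<lambda>x. v x - \<eta> x) < \<epsilon>}"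

definition H10_vec :: "(real^'d) set \<Rightarrow> (real^'d \<Rightarrow> real^'d) set" where
  "H10_vec \<Omega> = {u. \<forall>i. (\<lambda>x. u x $ i) \<in> H10 \<Omega>}"

definition H1_norm_vec :: "(real^'d) set \<Rightarrow> (real^'d \<Rightarrow> real^'d) \<Rightarrow> real" where
  "H1_norm_vec \<Omega> u = sqrt (\<Sum>i\<in>UNIV. (H1_norm \<Omega> (\<lambda>x. u x $ i))\<^sup>2)"

text \<open>\<open>H\<^sup>-\<^sup>1(\<Omega>)\<^sup>d\<close>, the dual of \<open>H\<^sup>1\<^sub>0(\<Omega>)\<^sup>d\<close>; the duality pairing is application.\<close>

definition Hm1 :: "(real^'d) set \<Rightarrow> ((real^'d \<Rightarrow> real^'d) \<Rightarrow> real) set" where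
  "Hm1 \<Omega> = {F.
     (\<forall>u\<in>H10_vec \<Omega>. \<forall>v\<in>H10_vec \<Omega>. \<forall>a b. F (\<lambda>x. a *\<^sub>R u x + b *\<^sub>R v x) = a * F u + b * F v) \<and>
     (\<exists>B. \<forall>v\<in>H10_vec \<Omega>. \<bar>F v\<bar> \<le> B * H1_norm_vec \<Omega> v)}"

definition Hm1_norm :: "(real^'d) set \<Rightarrow> ((real^'d \<Rightarrow> real^'d) \<Rightarrow> real) \<Rightarrow> real" where
  "Hm1_norm \<Omega> F = (SUP v\<in>{v\<in>H10_vec \<Omega>. H1_norm_vec \<Omega> v \<le> 1}. \<bar>F v\<bar>)"

text \<open>\<open>L\<^sup>2(0,T;H\<^sup>-\<^sup>1(\<Omega>)\<^sup>d)\<close>. The space \<open>H\<^sup>-\<^sup>1(\<Omega>)\<^sup>d\<close> is separable and reflexive, so strong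
  measurability coincides with measurability of all pairings with \<open>v \<in> H\<^sup>1\<^sub>0(\<Omega>)\<^sup>d\<close>.\<close>

definition L2_time_Hm1 ::
  "real \<Rightarrow> (real^'d) set \<Rightarrow> (real \<Rightarrow> (real^'d \<Rightarrow> real^'d) \<Rightarrow> real) set" where
  "L2_time_Hm1 T \<Omega> = {f.
     (AE t in lebesgue_on {0<..<T}. f t \<in> Hm1 \<Omega>) \<and>
     (\<forall>v\<in>H10_vec \<Omega>. (\<lambda>t. f t v) \<in> borel_measurable (lebesgue_on {0<..<T})) \<and>
     integrable (lebesgue_on {0<..<T}) (\<lambda>t. (Hm1_norm \<Omega> (f t))\<^sup>2)}"


section \<open>Finite element spaces\<close>

definition conforming_mesh :: "(real^'d) set \<Rightarrow> (real^'d) set set \<Rightarrow> bool" where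
  "conforming_mesh \<Omega> \<T> \<longleftrightarrow>
     triangulation \<T> \<and> (\<forall>K\<in>\<T>. int CARD('d) simplex K) \<and> \<Union>\<T> = closure \<Omega>"

definition V_h :: "(real^'d) set \<Rightarrow> (real^'d) set set \<Rightarrow> (real^'d \<Rightarrow> real) set" where
  "V_h \<Omega> \<T> = {v \<in> H1 \<Omega>. continuous_on (closure \<Omega>) v \<and>
                 (\<forall>K\<in>\<T>. \<exists>a b. \<forall>x\<in>K. v x = a \<bullet> x + b)}"

definition X_h :: "(real^'d) set \<Rightarrow> (real^'d) set set \<Rightarrow> (real^'d \<Rightarrow> real) set" where
  "X_h \<Omega> \<T> = {v \<in> V_h \<Omega> \<T>. \<forall>x\<in>frontier \<Omega>. v x = 0}"

definition X_h_vec :: "(real^'d) set \<Rightarrow> (real^'d) set set \<Rightarrow> (real^'d \<Rightarrow> real^'d) set" where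
  "X_h_vec \<Omega> \<T> = {u. \<forall>i. (\<lambda>x. u x $ i) \<in> X_h \<Omega> \<T>}"


section \<open>Model data and assumptions\<close>

text \<open>The fourth-order tensors \<open>\<C>\<close> and \<open>\<C>\<^sub>\<nu>\<close> are linear maps on matrices, so that
  \<open>D : \<C>(x) : G\<close> becomes \<open>D \<bullet> \<C> x G\<close> with the Frobenius inner product.\<close>

record ('d::finite) model =
  gam :: real
  Psi :: "real \<Rightarrow> real"
  Psi_vex :: "real \<Rightarrow> real"
  Psi_cav :: "real \<Rightarrow> real"
  eigenstrain :: "real \<Rightarrow> real^'d^'d"
  elast :: "real \<Rightarrow> (real^'d^'d) \<Rightarrow>\<^sub>L (real^'d^'d)"
  visc :: "real \<Rightarrow> (real^'d^'d) \<Rightarrow>\<^sub>L (real^'d^'d)"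
  mob :: "real \<Rightarrow> real"
  perm :: "real \<Rightarrow> real"
  biot_M :: "real \<Rightarrow> real"
  biot_alpha :: "real \<Rightarrow> real"
  src_r :: "real \<times> (real^'d^'d) \<times> real \<Rightarrow> real"
  src_s :: "real \<times> (real^'d^'d) \<times> real \<Rightarrow> real"

definition assm_A0 :: "(real^'d) set \<Rightarrow> bool" where
  "assm_A0 \<Omega> \<longleftrightarrow> CARD('d) \<in> {2, 3} \<and> bounded_lipschitz_domain \<Omega>"

definition assm_A1 :: "('d::finite) model \<Rightarrow> bool" where
  "assm_A1 D \<longleftrightarrow> gam D > 0"

definition assm_A2 :: "('d::finite) model \<Rightarrow> bool" where
  "assm_A2 D \<longleftrightarrow>
     C2_fun (Psi D) \<and> bdd_below (range (Psi D)) \<and>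
     (\<forall>x. Psi D x = Psi_vex D x + Psi_cav D x) \<and>
     convex_on UNIV (Psi_vex D) \<and> concave_on UNIV (Psi_cav D) \<and>
     (\<forall>x. Psi_vex D differentiable (at x)) \<and> (\<forall>x. Psi_cav D differentiable (at x)) \<and>
     (\<exists>q c1 c2. 0 \<le> q \<and> q \<le> 6 \<and> 0 \<le> c1 \<and> 0 \<le> c2 \<and>
        (\<forall>x. \<bar>Psi D x\<bar> \<le> c1 * \<bar>x\<bar> powr q + c2))"

text \<open>The two-sided bounds on the derivatives of the tensor are expressed through the operator norm.\<close>

definition elastic_tensor ::
  "(real \<Rightarrow> (real^'d^'d) \<Rightarrow>\<^sub>L (real^'d^'d)) \<Rightarrow> bool" where
  "elastic_tensor C \<longleftrightarrow>
     C2_fun C \<and>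
     (\<exists>c>0. \<forall>x G. transpose G = G \<longrightarrow> G \<bullet> C x G \<ge> c * (norm G)\<^sup>2) \<and>
     (\<forall>x G H. transpose G = G \<and> transpose H = H \<longrightarrow> H \<bullet> C x G = C x H \<bullet> G) \<and>
     (\<exists>B. \<forall>x. norm (vderiv C x) \<le> B \<and> norm (vderiv (vderiv C) x) \<le> B)"

definition assm_A3 :: "('d::finite) model \<Rightarrow> bool" where
  "assm_A3 D \<longleftrightarrow>
     C2_fun (eigenstrain D) \<and> (\<forall>x. transpose (eigenstrain D x) = eigenstrain D x) \<and>
     (\<exists>\<xi> a. \<forall>x. eigenstrain D x = (\<xi> * (x - a)) *\<^sub>R mat 1) \<and>
     elastic_tensor (elast D)"

definition assm_A4 :: "('d::finite) model \<Rightarrow> bool" where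
  "assm_A4 D \<longleftrightarrow> elastic_tensor (visc D)"

text \<open>Measurability is what makes \<open>\<langle>m(\<phi>)\<nabla>\<mu>, \<nabla>\<psi>\<rangle>\<close> and \<open>\<langle>\<kappa>(\<phi>)\<nabla>p, \<nabla>\<zeta>\<rangle>\<close>
  meaningful.\<close>

definition assm_A5 :: "('d::finite) model \<Rightarrow> bool" where
  "assm_A5 D \<longleftrightarrow>
     mob D \<in> borel_measurable borel \<and> perm D \<in> borel_measurable borel \<and>
     (\<exists>m0 m1. 0 < m0 \<and> 0 < m1 \<and> (\<forall>x. m0 \<le> mob D x \<and> mob D x \<le> m1)) \<and>
     (\<exists>k0 k1. 0 < k0 \<and> 0 < k1 \<and> (\<forall>x. k0 \<le> perm D x \<and> perm D x \<le> k1))"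

definition C2_bounded :: "(real \<Rightarrow> real) \<Rightarrow> bool" where
  "C2_bounded g \<longleftrightarrow> C2_fun g \<and>
     (\<exists>g0 g1 g2 g3. 0 < g0 \<and> 0 < g1 \<and> 0 < g2 \<and> 0 < g3 \<and>
        (\<forall>x. g0 \<le> g x \<and> g x \<le> g1 \<and> \<bar>deriv g x\<bar> \<le> g2 \<and> \<bar>deriv (deriv g) x\<bar> \<le> g3))"

definition assm_A6 :: "('d::finite) model \<Rightarrow> bool" where
  "assm_A6 D \<longleftrightarrow> C2_bounded (biot_M D) \<and> C2_bounded (biot_alpha D)"

definition assm_A7 ::
  "(real^'d) set \<Rightarrow> real \<Rightarrow> 'd model \<Rightarrow> (real \<Rightarrow> (real^'d \<Rightarrow> real^'d) \<Rightarrow> real) \<Rightarrow> bool" where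
  "assm_A7 \<Omega> T D f \<longleftrightarrow> f \<in> L2_time_Hm1 T \<Omega> \<and>
     C1_map (src_r D) \<and> C1_map (src_s D) \<and> bounded (range (src_r D)) \<and> bounded (range (src_s D))"


section \<open>Energy density\<close>

definition W :: "('d::finite) model \<Rightarrow> real \<Rightarrow> real^'d^'d \<Rightarrow> real" where
  "W D x G = (G - eigenstrain D x) \<bullet> elast D x (G - eigenstrain D x)"

definition W_red :: "('d::finite) model \<Rightarrow> real \<Rightarrow> real^'d^'d \<Rightarrow> real \<Rightarrow> real" where
  "W_red D x G \<theta> = W D x G + biot_M D x / 2 * (\<theta> - biot_alpha D x * trace G)\<^sup>2"

definition W_phi :: "('d::finite) model \<Rightarrow> real \<Rightarrow> real^'d^'d \<Rightarrow> real \<Rightarrow> real" where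
  "W_phi D x G \<theta> = deriv (\<lambda>y. W_red D y G \<theta>) x"

definition W_E :: "('d::finite) model \<Rightarrow> real \<Rightarrow> real^'d^'d \<Rightarrow> real \<Rightarrow> real^'d^'d" where
  "W_E D x G \<theta> = gradient (\<lambda>H. W_red D x H \<theta>) G"

definition W_theta :: "('d::finite) model \<Rightarrow> real \<Rightarrow> real^'d^'d \<Rightarrow> real \<Rightarrow> real" where
  "W_theta D x G \<theta> = deriv (\<lambda>z. W_red D x G z) \<theta>"

definition Psi_diff :: "('d::finite) model \<Rightarrow> real \<Rightarrow> real \<Rightarrow> real" where
  "Psi_diff D x1 x0 = deriv (Psi_vex D) x1 + deriv (Psi_cav D) x0"


section \<open>The time-discrete equations\<close>

text \<open>Below, the suffixes \<open>0\<close> and \<open>1\<close> mark the values at the time levels \<open>t\<^sup>n = n \<tau>\<close> and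
  \<open>t\<^sup>n\<^sup>+\<^sup>1\<close>.\<close>

definition d_tau :: "real \<Rightarrow> ('p \<Rightarrow> 'v::real_vector) \<Rightarrow> ('p \<Rightarrow> 'v) \<Rightarrow> 'p \<Rightarrow> 'v" where
  "d_tau \<tau> g0 g1 = (\<lambda>x. (1/\<tau>) *\<^sub>R (g1 x - g0 x))"

definition interval :: "real \<Rightarrow> nat \<Rightarrow> real set" where
  "interval \<tau> n = {real n * \<tau> <..< real (Suc n) * \<tau>}"

definition interp ::
  "real \<Rightarrow> nat \<Rightarrow> ('p \<Rightarrow> 'v::real_vector) \<Rightarrow> ('p \<Rightarrow> 'v) \<Rightarrow> real \<Rightarrow> 'p \<Rightarrow> 'v" where
  "interp \<tau> n g0 g1 t = (\<lambda>x. g0 x + ((t - real n * \<tau>) / \<tau>) *\<^sub>R (g1 x - g0 x))"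

definition W_phi_av ::
  "('d::finite) model \<Rightarrow> real \<Rightarrow> nat \<Rightarrow> (real^'d \<Rightarrow> real) \<Rightarrow> (real^'d \<Rightarrow> real) \<Rightarrow>
   (real^'d \<Rightarrow> real^'d^'d) \<Rightarrow> (real^'d \<Rightarrow> real) \<Rightarrow> real^'d \<Rightarrow> real" where
  "W_phi_av D \<tau> n \<phi>0 \<phi>1 E \<theta> x =
     (1/\<tau>) * integral\<^sup>L (lebesgue_on (interval \<tau> n))
                (\<lambda>t. W_phi D (interp \<tau> n \<phi>0 \<phi>1 t x) (E x) (\<theta> x))"

text \<open>Each of the following is the left-hand side minus the right-hand side of one equation.\<close>

definition res_phi ::
  "(real^'d) set \<Rightarrow> 'd model \<Rightarrow> real \<Rightarrow> (real^'d \<Rightarrow> real) \<Rightarrow>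
   (real^'d \<Rightarrow> real) \<Rightarrow> (real^'d \<Rightarrow> real) \<Rightarrow> (real^'d \<Rightarrow> real^'d) \<Rightarrow> (real^'d \<Rightarrow> real) \<Rightarrow>
   (real^'d \<Rightarrow> real) \<Rightarrow> real" where
  "res_phi \<Omega> D \<tau> \<phi>0 \<phi>1 \<mu>1 u1 \<theta>1 \<psi> =
     L2_inner \<Omega> (d_tau \<tau> \<phi>0 \<phi>1) \<psi>
     + L2_inner \<Omega> (\<lambda>x. mob D (\<phi>0 x) *\<^sub>R grad \<Omega> \<mu>1 x) (grad \<Omega> \<psi>)
     - L2_inner \<Omega> (\<lambda>x. src_r D (\<phi>0 x, symgrad \<Omega> u1 x, \<theta>1 x)) \<psi>"

definition res_mu ::
  "(real^'d) set \<Rightarrow> 'd model \<Rightarrow> real \<Rightarrow> nat \<Rightarrow> (real^'d \<Rightarrow> real) \<Rightarrow>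
   (real^'d \<Rightarrow> real) \<Rightarrow> (real^'d \<Rightarrow> real) \<Rightarrow> (real^'d \<Rightarrow> real^'d) \<Rightarrow> (real^'d \<Rightarrow> real) \<Rightarrow>
   (real^'d \<Rightarrow> real) \<Rightarrow> real" where
  "res_mu \<Omega> D \<tau> n \<phi>0 \<phi>1 \<mu>1 u1 \<theta>1 \<xi> =
     L2_inner \<Omega> \<mu>1 \<xi> - gam D * L2_inner \<Omega> (grad \<Omega> \<phi>1) (grad \<Omega> \<xi>)
     - L2_inner \<Omega> (\<lambda>x. Psi_diff D (\<phi>1 x) (\<phi>0 x)
                        + W_phi_av D \<tau> n \<phi>0 \<phi>1 (symgrad \<Omega> u1) \<theta>1 x) \<xi>"

definition res_u ::
  "(real^'d) set \<Rightarrow> 'd model \<Rightarrow> real \<Rightarrow> ((real^'d \<Rightarrow> real^'d) \<Rightarrow> real) \<Rightarrow>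
   (real^'d \<Rightarrow> real) \<Rightarrow> (real^'d \<Rightarrow> real^'d) \<Rightarrow> (real^'d \<Rightarrow> real^'d) \<Rightarrow> (real^'d \<Rightarrow> real) \<Rightarrow>
   (real^'d \<Rightarrow> real^'d) \<Rightarrow> real" where
  "res_u \<Omega> D \<tau> f1 \<phi>0 u0 u1 \<theta>1 v =
     L2_inner \<Omega> (\<lambda>x. visc D (\<phi>0 x) (symgrad \<Omega> (d_tau \<tau> u0 u1) x)) (symgrad \<Omega> v)
     + L2_inner \<Omega> (\<lambda>x. W_E D (\<phi>0 x) (symgrad \<Omega> u1 x) (\<theta>1 x)) (symgrad \<Omega> v)
     - f1 v"

definition res_theta ::
  "(real^'d) set \<Rightarrow> 'd model \<Rightarrow> real \<Rightarrow> (real^'d \<Rightarrow> real) \<Rightarrow> (real^'d \<Rightarrow> real^'d) \<Rightarrow>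
   (real^'d \<Rightarrow> real) \<Rightarrow> (real^'d \<Rightarrow> real) \<Rightarrow> (real^'d \<Rightarrow> real) \<Rightarrow> (real^'d \<Rightarrow> real) \<Rightarrow> real" where
  "res_theta \<Omega> D \<tau> \<phi>0 u0 \<theta>0 \<theta>1 p1 \<zeta> =
     L2_inner \<Omega> (d_tau \<tau> \<theta>0 \<theta>1) \<zeta>
     + L2_inner \<Omega> (\<lambda>x. perm D (\<phi>0 x) *\<^sub>R grad \<Omega> p1 x) (grad \<Omega> \<zeta>)
     - L2_inner \<Omega> (\<lambda>x. src_s D (\<phi>0 x, symgrad \<Omega> u0 x, \<theta>0 x)) \<zeta>"

definition res_p ::
  "(real^'d) set \<Rightarrow> 'd model \<Rightarrow> (real^'d \<Rightarrow> real) \<Rightarrow> (real^'d \<Rightarrow> real^'d) \<Rightarrow>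
   (real^'d \<Rightarrow> real) \<Rightarrow> (real^'d \<Rightarrow> real) \<Rightarrow> (real^'d \<Rightarrow> real) \<Rightarrow> real" where
  "res_p \<Omega> D \<phi>0 u1 \<theta>1 p1 q =
     L2_inner \<Omega> p1 q
     - L2_inner \<Omega> (\<lambda>x. W_theta D (\<phi>0 x) (symgrad \<Omega> u1 x) (\<theta>1 x)) q"

definition P_step ::
  "(real^'d) set \<Rightarrow> (real^'d) set set \<Rightarrow> 'd model \<Rightarrow> real \<Rightarrow> nat \<Rightarrow>
   ((real^'d \<Rightarrow> real^'d) \<Rightarrow> real) \<Rightarrow>
   (real^'d \<Rightarrow> real) \<times> (real^'d \<Rightarrow> real^'d) \<times> (real^'d \<Rightarrow> real) \<Rightarrow>
   (real^'d \<Rightarrow> real) \<times> (real^'d \<Rightarrow> real) \<times> (real^'d \<Rightarrow> real^'d) \<times> (real^'d \<Rightarrow> real) \<times>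
     (real^'d \<Rightarrow> real) \<Rightarrow> bool" where
  "P_step \<Omega> \<T> D \<tau> n f1 = (\<lambda>(\<phi>0, u0, \<theta>0) (\<phi>1, \<mu>1, u1, \<theta>1, p1).
     \<phi>1 \<in> V_h \<Omega> \<T> \<and> \<mu>1 \<in> V_h \<Omega> \<T> \<and> u1 \<in> X_h_vec \<Omega> \<T> \<and> \<theta>1 \<in> V_h \<Omega> \<T> \<and> p1 \<in> V_h \<Omega> \<T> \<and>
     (\<forall>\<psi>\<in>V_h \<Omega> \<T>. \<forall>\<xi>\<in>V_h \<Omega> \<T>. \<forall>v\<in>X_h_vec \<Omega> \<T>. \<forall>\<zeta>\<in>V_h \<Omega> \<T>. \<forall>q\<in>V_h \<Omega> \<T>.
        res_phi \<Omega> D \<tau> \<phi>0 \<phi>1 \<mu>1 u1 \<theta>1 \<psi> = 0 \<and>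
        res_mu \<Omega> D \<tau> n \<phi>0 \<phi>1 \<mu>1 u1 \<theta>1 \<xi> = 0 \<and>
        res_u \<Omega> D \<tau> f1 \<phi>0 u0 u1 \<theta>1 v = 0 \<and>
        res_theta \<Omega> D \<tau> \<phi>0 u0 \<theta>0 \<theta>1 p1 \<zeta> = 0 \<and>
        res_p \<Omega> D \<phi>0 u1 \<theta>1 p1 q = 0))"


section \<open>The two decoupled steps\<close>

definition first_residual ::
  "(real^'d) set \<Rightarrow> 'd model \<Rightarrow> real \<Rightarrow> ((real^'d \<Rightarrow> real^'d) \<Rightarrow> real) \<Rightarrow>
   (real^'d \<Rightarrow> real) \<times> (real^'d \<Rightarrow> real^'d) \<times> (real^'d \<Rightarrow> real) \<Rightarrow>
   (real^'d \<Rightarrow> real^'d) \<times> (real^'d \<Rightarrow> real) \<times> (real^'d \<Rightarrow> real) \<Rightarrow>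
   (real^'d \<Rightarrow> real^'d) \<times> (real^'d \<Rightarrow> real) \<times> (real^'d \<Rightarrow> real) \<Rightarrow> real \<times> real \<times> real" where
  "first_residual \<Omega> D \<tau> f1 = (\<lambda>(\<phi>0, u0, \<theta>0) (u1, \<theta>1, p1) (v, \<zeta>, q).
     (res_u \<Omega> D \<tau> f1 \<phi>0 u0 u1 \<theta>1 v,
      res_theta \<Omega> D \<tau> \<phi>0 u0 \<theta>0 \<theta>1 p1 \<zeta>,
      res_p \<Omega> D \<phi>0 u1 \<theta>1 p1 q))"

definition first_space ::
  "(real^'d) set \<Rightarrow> (real^'d) set set \<Rightarrow>
   ((real^'d \<Rightarrow> real^'d) \<times> (real^'d \<Rightarrow> real) \<times> (real^'d \<Rightarrow> real)) set" where
  "first_space \<Omega> \<T> = X_h_vec \<Omega> \<T> \<times> V_h \<Omega> \<T> \<times> V_h \<Omega> \<T>"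

definition first_step ::
  "(real^'d) set \<Rightarrow> (real^'d) set set \<Rightarrow> 'd model \<Rightarrow> real \<Rightarrow> ((real^'d \<Rightarrow> real^'d) \<Rightarrow> real) \<Rightarrow>
   (real^'d \<Rightarrow> real) \<times> (real^'d \<Rightarrow> real^'d) \<times> (real^'d \<Rightarrow> real) \<Rightarrow>
   (real^'d \<Rightarrow> real^'d) \<times> (real^'d \<Rightarrow> real) \<times> (real^'d \<Rightarrow> real) \<Rightarrow> bool" where
  "first_step \<Omega> \<T> D \<tau> f1 old z \<longleftrightarrow> z \<in> first_space \<Omega> \<T> \<and>
     (\<forall>w\<in>first_space \<Omega> \<T>. first_residual \<Omega> D \<tau> f1 old z w = (0, 0, 0))"

definition second_residual ::
  "(real^'d) set \<Rightarrow> 'd model \<Rightarrow> real \<Rightarrow> nat \<Rightarrow> (real^'d \<Rightarrow> real) \<Rightarrow>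
   (real^'d \<Rightarrow> real^'d) \<times> (real^'d \<Rightarrow> real) \<Rightarrow>
   (real^'d \<Rightarrow> real) \<times> (real^'d \<Rightarrow> real) \<Rightarrow> (real^'d \<Rightarrow> real) \<times> (real^'d \<Rightarrow> real) \<Rightarrow>
   real \<times> real" where
  "second_residual \<Omega> D \<tau> n \<phi>0 = (\<lambda>(u1, \<theta>1) (\<phi>1, \<mu>1) (\<psi>, \<xi>).
     (res_phi \<Omega> D \<tau> \<phi>0 \<phi>1 \<mu>1 u1 \<theta>1 \<psi>,
      L2_inner \<Omega> \<mu>1 \<xi> - gam D * L2_inner \<Omega> (grad \<Omega> \<phi>1) (grad \<Omega> \<xi>)
      - L2_inner \<Omega> (\<lambda>x. Psi_diff D (\<phi>1 x) (\<phi>0 x)) \<xi>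
      - L2_inner \<Omega> (W_phi_av D \<tau> n \<phi>0 \<phi>1 (symgrad \<Omega> u1) \<theta>1) \<xi>))"

definition second_space ::
  "(real^'d) set \<Rightarrow> (real^'d) set set \<Rightarrow> ((real^'d \<Rightarrow> real) \<times> (real^'d \<Rightarrow> real)) set" where
  "second_space \<Omega> \<T> = V_h \<Omega> \<T> \<times> V_h \<Omega> \<T>"

definition second_step ::
  "(real^'d) set \<Rightarrow> (real^'d) set set \<Rightarrow> 'd model \<Rightarrow> real \<Rightarrow> nat \<Rightarrow> (real^'d \<Rightarrow> real) \<Rightarrow>
   (real^'d \<Rightarrow> real^'d) \<times> (real^'d \<Rightarrow> real) \<Rightarrow>
   (real^'d \<Rightarrow> real) \<times> (real^'d \<Rightarrow> real) \<Rightarrow> bool" where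
  "second_step \<Omega> \<T> D \<tau> n \<phi>0 y z \<longleftrightarrow> z \<in> second_space \<Omega> \<T> \<and>
     (\<forall>w\<in>second_space \<Omega> \<T>. second_residual \<Omega> D \<tau> n \<phi>0 y z w = (0, 0))"


section \<open>Problem (P)\<close>

definition Pi1c ::
  "real \<Rightarrow> nat \<Rightarrow> 'p set \<Rightarrow> ('p \<Rightarrow> 'v::real_vector) set \<Rightarrow> (real \<Rightarrow> 'p \<Rightarrow> 'v) set" where
  "Pi1c \<tau> nT S X = {g.
     (\<forall>t\<in>{0..real nT * \<tau>}. g t \<in> X) \<and>
     (\<forall>n<nT. \<forall>t\<in>{real n * \<tau>..real (Suc n) * \<tau>}. \<forall>x\<in>S.
        g t x = interp \<tau> n (g (real n * \<tau>)) (g (real (Suc n) * \<tau>)) t x)}"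

definition Pi0 ::
  "real \<Rightarrow> nat \<Rightarrow> 'p set \<Rightarrow> ('p \<Rightarrow> 'v) set \<Rightarrow> (real \<Rightarrow> 'p \<Rightarrow> 'v) set" where
  "Pi0 \<tau> nT S X = {g. \<forall>n<nT. \<forall>t\<in>interval \<tau> n.
     g t \<in> X \<and> (\<forall>t'\<in>interval \<tau> n. \<forall>x\<in>S. g t x = g t' x)}"

text \<open>The constant value \<open>g\<^sup>n\<^sup>+\<^sup>1\<close> of \<open>g \<in> Pi0\<close> on \<open>I\<^sub>n\<close>, read off at the midpoint.\<close>

definition cell_value :: "real \<Rightarrow> (real \<Rightarrow> 'b) \<Rightarrow> nat \<Rightarrow> 'b" where
  "cell_value \<tau> g n = g ((real n + 1/2) * \<tau>)"

text \<open>Membership in the space-time spaces and the initial conditions of (P), without its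
  equations.\<close>

definition P_admissible ::
  "(real^'d) set \<Rightarrow> (real^'d) set set \<Rightarrow> real \<Rightarrow> nat \<Rightarrow>
   (real^'d \<Rightarrow> real) \<times> (real^'d \<Rightarrow> real^'d) \<times> (real^'d \<Rightarrow> real) \<Rightarrow>
   (real \<Rightarrow> real^'d \<Rightarrow> real) \<times> (real \<Rightarrow> real^'d \<Rightarrow> real) \<times> (real \<Rightarrow> real^'d \<Rightarrow> real^'d) \<times>
     (real \<Rightarrow> real^'d \<Rightarrow> real) \<times> (real \<Rightarrow> real^'d \<Rightarrow> real) \<Rightarrow> bool" where
  "P_admissible \<Omega> \<T> \<tau> nT = (\<lambda>(\<phi>i, ui, \<theta>i) (\<phi>, \<mu>, u, \<theta>, p).
     \<phi> \<in> Pi1c \<tau> nT (closure \<Omega>) (V_h \<Omega> \<T>) \<and> u \<in> Pi1c \<tau> nT (closure \<Omega>) (X_h_vec \<Omega> \<T>) \<and>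
     \<theta> \<in> Pi1c \<tau> nT (closure \<Omega>) (V_h \<Omega> \<T>) \<and>
     \<mu> \<in> Pi0 \<tau> nT (closure \<Omega>) (V_h \<Omega> \<T>) \<and> p \<in> Pi0 \<tau> nT (closure \<Omega>) (V_h \<Omega> \<T>) \<and>
     (\<forall>x\<in>closure \<Omega>. \<phi> 0 x = \<phi>i x \<and> u 0 x = ui x \<and> \<theta> 0 x = \<theta>i x))"

text \<open>\<open>fd n\<close> is the evaluation or approximation of the load at \<open>t\<^sup>n\<close>.\<close>

definition solves_P ::
  "(real^'d) set \<Rightarrow> (real^'d) set set \<Rightarrow> 'd model \<Rightarrow> real \<Rightarrow> nat \<Rightarrow>
   (nat \<Rightarrow> (real^'d \<Rightarrow> real^'d) \<Rightarrow> real) \<Rightarrow>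
   (real^'d \<Rightarrow> real) \<times> (real^'d \<Rightarrow> real^'d) \<times> (real^'d \<Rightarrow> real) \<Rightarrow>
   (real \<Rightarrow> real^'d \<Rightarrow> real) \<times> (real \<Rightarrow> real^'d \<Rightarrow> real) \<times> (real \<Rightarrow> real^'d \<Rightarrow> real^'d) \<times>
     (real \<Rightarrow> real^'d \<Rightarrow> real) \<times> (real \<Rightarrow> real^'d \<Rightarrow> real) \<Rightarrow> bool" where
  "solves_P \<Omega> \<T> D \<tau> nT fd init = (\<lambda>(\<phi>, \<mu>, u, \<theta>, p).
     P_admissible \<Omega> \<T> \<tau> nT init (\<phi>, \<mu>, u, \<theta>, p) \<and>
     (\<forall>n<nT. P_step \<Omega> \<T> D \<tau> n (fd (Suc n))
        (\<phi> (real n * \<tau>), u (real n * \<tau>), \<theta> (real n * \<tau>))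
        (\<phi> (real (Suc n) * \<tau>), cell_value \<tau> \<mu> n, u (real (Suc n) * \<tau>),
         \<theta> (real (Suc n) * \<tau>), cell_value \<tau> p n)))"

definition solves_decoupled ::
  "(real^'d) set \<Rightarrow> (real^'d) set set \<Rightarrow> 'd model \<Rightarrow> real \<Rightarrow> nat \<Rightarrow>
   (nat \<Rightarrow> (real^'d \<Rightarrow> real^'d) \<Rightarrow> real) \<Rightarrow>
   (real^'d \<Rightarrow> real) \<times> (real^'d \<Rightarrow> real^'d) \<times> (real^'d \<Rightarrow> real) \<Rightarrow>
   (real \<Rightarrow> real^'d \<Rightarrow> real) \<times> (real \<Rightarrow> real^'d \<Rightarrow> real) \<times> (real \<Rightarrow> real^'d \<Rightarrow> real^'d) \<times>
     (real \<Rightarrow> real^'d \<Rightarrow> real) \<times> (real \<Rightarrow> real^'d \<Rightarrow> real) \<Rightarrow> bool" where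
  "solves_decoupled \<Omega> \<T> D \<tau> nT fd init = (\<lambda>(\<phi>, \<mu>, u, \<theta>, p).
     P_admissible \<Omega> \<T> \<tau> nT init (\<phi>, \<mu>, u, \<theta>, p) \<and>
     (\<forall>n<nT.
        first_step \<Omega> \<T> D \<tau> (fd (Suc n))
          (\<phi> (real n * \<tau>), u (real n * \<tau>), \<theta> (real n * \<tau>))
          (u (real (Suc n) * \<tau>), \<theta> (real (Suc n) * \<tau>), cell_value \<tau> p n) \<and>
        second_step \<Omega> \<T> D \<tau> n (\<phi> (real n * \<tau>))
          (u (real (Suc n) * \<tau>), \<theta> (real (Suc n) * \<tau>))
          (\<phi> (real (Suc n) * \<tau>), cell_value \<tau> \<mu> n)))"

end

theory Submission
  imports Defs
begin

text \<open>The equations for \<open>(u, \<theta>, p)\<close> evaluate the coefficients at the old \<open>\<phi>\<^sup>n\<close> only, so the step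
  decouples; the only analytic point of the equivalence is that \<open>\<Psi>'\<close> and the averaged
  \<open>\<phi>\<close>-derivative of the energy are separately integrable against test functions. This holds
  because the derivatives of the convex and concave parts are monotone, hence bounded along bounded
  functions, and the energy derivative grows quadratically in the square-integrable \<open>\<E>(u)\<close>.
  The reduced energy is quadratic in \<open>(\<E>(u), \<theta>)\<close>, so the first system is affine once the
  chosen representative of the weak gradient is known to be linear almost everywhere; that is
  uniqueness of weak gradients. For nonlinearity of the second system compare \<open>\<Psi>(x) = x\<^sup>4\<close> with
  \<open>\<Psi> = 0\<close> on constant functions.\<close>

section \<open>The fundamental lemma of the calculus of variations\<close>

text \<open>The obstacles come from operators that are total. The integral is a Bochner integral
  with value 0 on functions that are not integrable, so a sum under it may be split only after
  integrability has been shown. \<open>grad\<close> is a choice of representative, so identities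
  between gradients hold off null sets and are carried through the pairings in that form.
  \<open>W_E\<close> is a gradient over all matrices, while the tensors are symmetric only on
  symmetric ones; it is therefore never computed, only tested against symmetric matrices. The energy
  derivative is controlled only in L1, which the boundedness of finite element functions
  compensates. Constants must be recognised as finite element functions: they make the test spaces
  inhabited, so that the joint quantification over five test functions can be separated, and they
  are the points at which nonlinearity is read off. Their weak gradient is 0 because gradients of
  test functions have integral 0.\<close>

lemma DERIV_max0_square: "((\<lambda>s::real. (max 0 s)\<^sup>2) has_real_derivative 2 * max 0 s) (at s)"
proof -
  consider "s < 0" | "s = 0" | "s > 0" by linarith
  then show ?thesis
  proof cases
    case 1
    have "((\<lambda>s::real. 0) has_real_derivative 0) (at s)" by simp
    then have "((\<lambda>s::real. (max 0 s)\<^sup>2) has_real_derivative 0) (at s)"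
      by (rule has_field_derivative_transform_within_open[where S="{..<0}"]) (use 1 in auto)
    then show ?thesis using 1 by simp
  next
    case 2
    \<comment> \<open>At the kink the difference quotient is the positive part of \<open>h\<close>
      itself.\<close>
    have "((\<lambda>h::real. (max 0 h)\<^sup>2 / h) \<longlongrightarrow> 0) (at 0)"
    proof (rule Lim_null_comparison)
      show "\<forall>\<^sub>F h in at (0::real). norm ((max 0 h)\<^sup>2 / h) \<le> \<bar>h\<bar>"
        by (rule always_eventually) (auto simp: max_def power2_eq_square)
      show "((\<lambda>h::real. \<bar>h\<bar>) \<longlongrightarrow> 0) (at 0)"
        by (rule tendsto_rabs_zero) simp
    qed
    then show ?thesis using 2 by (simp add: DERIV_def)
  next
    case 3
    have "((\<lambda>s::real. s\<^sup>2) has_real_derivative 2 * s) (at s)"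
      by (auto intro!: derivative_eq_intros)
    then have "((\<lambda>s::real. (max 0 s)\<^sup>2) has_real_derivative 2 * s) (at s)"
      by (rule has_field_derivative_transform_within_open[where S="{0<..}"]) (use 3 in auto)
    then show ?thesis using 3 by simp
  qed
qed

text \<open>The outer square removes the kink on the sphere of radius \<open>r\<close>, so the
  gradient is continuous, which is all the smoothness that \<open>C1c\<close> asks for.\<close>

definition bump :: "'a::euclidean_space \<Rightarrow> real \<Rightarrow> 'a \<Rightarrow> real" where
  "bump c r x = (max 0 (r\<^sup>2 - (norm (x - c))\<^sup>2))\<^sup>2"

lemma bump_nonneg: "0 \<le> bump c r x"
  by (simp add: bump_def)

lemma bump_pos_iff: "r > 0 \<Longrightarrow> 0 < bump c r x \<longleftrightarrow> x \<in> ball c r"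
  by (auto simp: bump_def dist_norm norm_minus_commute max_def power_less_imp_less_base
      intro: power_strict_mono)

lemma GDERIV_bump:
  "GDERIV (bump c r) x :> (- 4 * max 0 (r\<^sup>2 - (norm (x - c))\<^sup>2)) *\<^sub>R (x - c)"
proof -
  have 1: "GDERIV (\<lambda>x. r\<^sup>2 - (norm (x - c))\<^sup>2) x :> (-2) *\<^sub>R (x - c)"
    unfolding gderiv_def power2_norm_eq_inner
    by (auto intro!: derivative_eq_intros simp: inner_commute algebra_simps)
  show ?thesis
    using GDERIV_DERIV_compose[OF 1 DERIV_max0_square]
    by (simp add: bump_def[abs_def] mult_ac)
qed

lemma GDERIV_sum:
  "finite I \<Longrightarrow> (\<And>i. i \<in> I \<Longrightarrow> GDERIV (f i) x :> G i) \<Longrightarrow>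
    GDERIV (\<lambda>x. \<Sum>i\<in>I. f i x) x :> (\<Sum>i\<in>I. G i)"
  unfolding gderiv_def by (auto intro!: derivative_eq_intros simp: inner_sum_right)

lemma gradient_eqI:
  assumes "GDERIV f x :> D" shows "gradient f x = D"
  unfolding gradient_def
proof (rule the_equality[where P="\<lambda>D. GDERIV f x :> D", OF assms])
  fix D' assume "GDERIV f x :> D'"
  then have "(\<lambda>h. h \<bullet> D') = (\<lambda>h. h \<bullet> D)"
    using assms unfolding gderiv_def by (rule has_derivative_unique)
  then show "D' = D"
    by (metis inner_commute vector_eq_ldot)
qed

text \<open>These functions increase to the indicator function of the union of the balls as \<open>k \<rightarrow> \<infinity>\<close>.\<close>

definition soft_indicator :: "('a::euclidean_space \<times> real) set \<Rightarrow> real \<Rightarrow> 'a \<Rightarrow> real" where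
  "soft_indicator I k x = (let s = k * (\<Sum>(c, r)\<in>I. bump c r x) in s / (1 + s))"

lemma soft_indicator_bounds:
  assumes "k \<ge> 0"
  shows "0 \<le> soft_indicator I k x" "soft_indicator I k x \<le> 1"
proof -
  have "0 \<le> k * (\<Sum>(c, r)\<in>I. bump c r x)"
    using assms by (auto intro!: mult_nonneg_nonneg sum_nonneg bump_nonneg)
  then show "0 \<le> soft_indicator I k x" "soft_indicator I k x \<le> 1"
    by (auto simp: soft_indicator_def Let_def divide_simps)
qed

text \<open>Finitely many closed balls have a compact union, and a finite sum may be differentiated
  termwise. The outer function s -> k s / (1 + k s) causes no trouble, because bumps are nonnegative
  and the denominator is at least 1.\<close>

lemma soft_indicator_C1c:
  assumes fin: "finite I" and r: "\<And>c r. (c, r) \<in> I \<Longrightarrow> r > 0 \<and> cball c r \<subseteq> \<Omega>" and k: "k \<ge> 0"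
  shows "soft_indicator I k \<in> C1c \<Omega>"
proof -
  let ?h = "\<lambda>x. \<Sum>(c, r)\<in>I. bump c r x"
  let ?g = "\<lambda>x. \<Sum>(c, r)\<in>I. (- 4 * max 0 (r\<^sup>2 - (norm (x - c))\<^sup>2)) *\<^sub>R (x - c)"
  let ?G = "\<lambda>x. (k / (1 + k * ?h x)\<^sup>2) *\<^sub>R ?g x"
  have h0: "0 \<le> k * ?h x" for x
    using k by (auto intro!: mult_nonneg_nonneg sum_nonneg bump_nonneg)
  have h1: "1 + k * ?h x \<noteq> 0" for x using h0[of x] by linarith
  have "GDERIV (soft_indicator I k) x :> ?G x" for x
  proof -
    have 1: "GDERIV ?h x :> ?g x"
      unfolding split_def by (intro GDERIV_sum fin GDERIV_bump)
    have 2: "((\<lambda>s. k * s / (1 + k * s)) has_real_derivative k / (1 + k * ?h x)\<^sup>2) (at (?h x))"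
      using h1[of x] by (auto intro!: derivative_eq_intros simp: power2_eq_square field_simps)
    show ?thesis
      using GDERIV_DERIV_compose[OF 1 2] by (simp add: soft_indicator_def[abs_def] Let_def)
  qed
  moreover have "continuous_on UNIV ?G"
    unfolding split_def bump_def
    by (intro continuous_intros) (use h1 in \<open>auto simp: split_def bump_def\<close>)
  moreover have "compact (\<Union>(c, r)\<in>I. cball c r)"
    using fin by (auto intro!: compact_UN)
  moreover have "soft_indicator I k x = 0" if "x \<notin> (\<Union>(c, r)\<in>I. cball c r)" for x
  proof -
    have "bump c r x = 0" if "(c, r) \<in> I" for c r
    proof -
      have "\<not> 0 < bump c r x"
        using bump_pos_iff[of r c x] r[OF that] \<open>x \<notin> _\<close> that by force
      then show ?thesis using bump_nonneg[of c r x] by linarith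
    qed
    then have "?h x = 0" by (auto intro!: sum.neutral)
    then show ?thesis by (simp add: soft_indicator_def)
  qed
  moreover have "(\<Union>(c, r)\<in>I. cball c r) \<subseteq> \<Omega>"
    using r by blast
  ultimately show ?thesis
    unfolding C1c_def by blast
qed

section \<open>Regularity, support and bounds of test functions\<close>

lemma C1c_continuous: "\<eta> \<in> C1c \<Omega> \<Longrightarrow> continuous_on S \<eta>"
  by (auto simp: C1c_def gderiv_def intro!: continuous_at_imp_continuous_on dest: has_derivative_continuous)

lemma C1c_gradient:
  assumes "\<eta> \<in> C1c \<Omega>"
  shows "GDERIV \<eta> x :> gradient \<eta> x" "continuous_on S (gradient \<eta>)"
proof -
  obtain G where G: "continuous_on UNIV G" "\<And>x. GDERIV \<eta> x :> G x"
    using assms by (auto simp: C1c_def)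
  have "gradient \<eta> = G" using G(2) by (auto intro!: ext gradient_eqI)
  then show "GDERIV \<eta> x :> gradient \<eta> x" "continuous_on S (gradient \<eta>)"
    using G by (auto intro: continuous_on_subset)
qed

lemma C1c_compact_support:
  assumes "\<eta> \<in> C1c \<Omega>"
  obtains K where "compact K" "K \<subseteq> \<Omega>" "\<And>x. x \<notin> K \<Longrightarrow> \<eta> x = 0" "\<And>x. x \<notin> K \<Longrightarrow> gradient \<eta> x = 0"
proof -
  obtain K where K: "compact K" "K \<subseteq> \<Omega>" "\<And>x. x \<notin> K \<Longrightarrow> \<eta> x = 0"
    using assms by (auto simp: C1c_def)
  have "gradient \<eta> x = 0" if "x \<notin> K" for x
  proof (rule gradient_eqI)
    \<comment> \<open>The complement of the support is open, so \<eta> agrees with 0 near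
      \<open>x\<close> and not only at \<open>x\<close>.\<close>
    have "open (- K)" using K(1) by (simp add: compact_imp_closed open_Compl)
    have "GDERIV (\<lambda>x. 0) x :> 0" by (rule GDERIV_const)
    then show "GDERIV \<eta> x :> 0"
      unfolding gderiv_def
      by (rule has_derivative_transform_within_open[OF _ \<open>open (- K)\<close>]) (use that K(3) in auto)
  qed
  then show ?thesis using K that by blast
qed

lemma C1c_bounded:
  assumes "\<eta> \<in> C1c \<Omega>"
  obtains B where "B \<ge> 0" "\<And>x. \<bar>\<eta> x\<bar> \<le> B" "\<And>x. norm (gradient \<eta> x) \<le> B"
proof -
  obtain K where K: "compact K" "\<And>x. x \<notin> K \<Longrightarrow> \<eta> x = 0" "\<And>x. x \<notin> K \<Longrightarrow> gradient \<eta> x = 0"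
    using C1c_compact_support[OF assms] by metis
  have "bounded (\<eta> ` K)" "bounded (gradient \<eta> ` K)"
    using K(1) C1c_continuous[OF assms] C1c_gradient(2)[OF assms]
    by (auto intro!: compact_imp_bounded compact_continuous_image)
  then obtain B1 B2 where B: "\<And>x. x \<in> K \<Longrightarrow> \<bar>\<eta> x\<bar> \<le> B1" "\<And>x. x \<in> K \<Longrightarrow> norm (gradient \<eta> x) \<le> B2"
    by (auto simp: bounded_iff)
  show ?thesis
  proof (rule that[of "max 0 (max B1 B2)"])
    fix x
    show "\<bar>\<eta> x\<bar> \<le> max 0 (max B1 B2)" "norm (gradient \<eta> x) \<le> max 0 (max B1 B2)"
      using B[of x] K(2,3)[of x] by (cases "x \<in> K"; force)+
  qed simp
qed

lemma continuous_borel_measurable_lebesgue_on: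
  fixes f :: "'a::euclidean_space \<Rightarrow> 'b::euclidean_space"
  assumes "continuous_on S f" "S \<in> sets lebesgue"
  shows "f \<in> borel_measurable (lebesgue_on S)"
  using assms by (rule continuous_imp_measurable_on_sets_lebesgue)

text \<open>By dominated convergence the hypothesis extends from test functions to indicators of open
  sets, and by Dynkin's theorem to indicators of all measurable sets.\<close>

lemma fundamental_lemma_open:
  fixes f :: "'a::euclidean_space \<Rightarrow> real"
  assumes \<Omega>: "\<Omega> \<in> lmeasurable" and f: "integrable (lebesgue_on \<Omega>) f"
    and zero: "\<And>\<eta>. \<eta> \<in> C1c \<Omega> \<Longrightarrow> integral\<^sup>L (lebesgue_on \<Omega>) (\<lambda>x. \<eta> x * f x) = 0"
    and U: "open U" "U \<subseteq> \<Omega>"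
  shows "integral\<^sup>L (lebesgue_on \<Omega>) (\<lambda>x. indicator U x * f x) = 0"
proof (cases "U = {}")
  case False
  \<comment> \<open>Asking for the closed ball to lie in \<open>U\<close> puts the supports of the
    bumps inside \<open>U\<close>, while the open balls still cover \<open>U\<close>. A countable
    subcover is taken because dominated convergence works along sequences.\<close>
  define Q where "Q = {(c, r). r > 0 \<and> cball c r \<subseteq> U}"
  have "\<exists>\<F>' \<subseteq> (\<lambda>(c, r). ball c r) ` Q. countable \<F>' \<and> \<Union>\<F>' = \<Union>((\<lambda>(c, r). ball c r) ` Q)"
    by (rule Lindelof[of "(\<lambda>(c, r). ball c r) ` Q"]) auto
  then obtain P where P: "countable P" "P \<subseteq> Q" "\<Union>((\<lambda>(c, r). ball c r) ` P) = \<Union>((\<lambda>(c, r). ball c r) ` Q)"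
    by (metis countable_subset_image)
  have "\<Union>((\<lambda>(c, r). ball c r) ` Q) = U"
  proof
    show "\<Union>((\<lambda>(c, r). ball c r) ` Q) \<subseteq> U" 
      using ball_subset_cball by (fastforce simp: Q_def)
    show "U \<subseteq> \<Union>((\<lambda>(c, r). ball c r) ` Q)"
      using U(1) open_contains_cball by (fastforce simp: Q_def)
  qed
  with P have PU: "(\<Union>(c, r)\<in>P. ball c r) = U" by simp
  with False have Pne: "P \<noteq> {}" by auto
  \<comment> \<open>The n-th test function uses the first n balls with sharpness n, so the family
    and the sharpness grow together.\<close>
  define I where "I n = from_nat_into P ` {..<n}" for n :: nat
  have Isub: "I n \<subseteq> P" for n
    using from_nat_into[OF Pne] by (auto simp: I_def)
  have Q: "r > 0 \<and> cball c r \<subseteq> U" if "(c, r) \<in> I n" for c r n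
    using Isub P(2) that by (auto simp: Q_def)
  have fin: "finite (I n)" for n by (simp add: I_def)
  have C1: "soft_indicator (I n) (real n) \<in> C1c \<Omega>" for n
    using Q U(2) by (intro soft_indicator_C1c fin) (blast | simp)+
  have lim: "(\<lambda>n. soft_indicator (I n) (real n) x) \<longlonglongrightarrow> indicator U x" for x
  proof (cases "x \<in> U")
    case True
    then obtain c r where cr: "(c, r) \<in> P" "x \<in> ball c r" using PU by auto
    then obtain m where m: "from_nat_into P m = (c, r)" 
      using P(1) Pne by (metis from_nat_into_surj)
    define s where "s n = real n * (\<Sum>(c, r)\<in>I n. bump c r x)" for n
    have rpos: "r > 0" using cr(1) P(2) by (auto simp: Q_def)
    have b: "bump c r x > 0" using cr rpos by (simp add: bump_pos_iff)
    \<comment> \<open>A single ball of the cover that contains \<open>x\<close> already drives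
      \<open>s n\<close> to infinity, and s / (1 + s) then tends to 1.\<close>
    have "real n * bump c r x \<le> s n" if "n > m" for n
    proof -
      have "(c, r) \<in> I n" using m that by (force simp: I_def)
      then have "bump c r x \<le> (\<Sum>(c, r)\<in>I n. bump c r x)"
        using member_le_sum[of "(c, r)" "I n" "\<lambda>(c, r). bump c r x"] fin bump_nonneg by auto
      then show ?thesis unfolding s_def by (rule mult_left_mono) simp
    qed
    then have "\<forall>\<^sub>F n in sequentially. real n * bump c r x \<le> s n"
      by (auto simp: eventually_sequentially intro!: exI[of _ "Suc m"])
    moreover have "filterlim (\<lambda>n. real n * bump c r x) at_top sequentially"
      using filterlim_at_top_mult_tendsto_pos[OF tendsto_const b filterlim_real_sequentially] .
    ultimately have "filterlim s at_top sequentially"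
      by (rule filterlim_at_top_mono[rotated])
    then have "((\<lambda>n. 1 - 1 / (1 + s n)) \<longlongrightarrow> 1 - 0) sequentially"
      by (intro tendsto_diff tendsto_const real_tendsto_divide_at_top[OF tendsto_const]
          filterlim_tendsto_add_at_top[OF tendsto_const])
    moreover have "soft_indicator (I n) (real n) x = 1 - 1 / (1 + s n)" for n
    proof -
      have "0 \<le> s n" unfolding s_def by (auto intro!: mult_nonneg_nonneg sum_nonneg bump_nonneg)
      then show ?thesis by (simp add: soft_indicator_def Let_def s_def[symmetric] field_simps)
    qed
    ultimately show ?thesis using True by simp
  next
    case False
    have "soft_indicator (I n) (real n) x = 0" for n
    proof -
      have "bump c r x = 0" if "(c, r) \<in> I n" for c r
        using bump_pos_iff[of r c x] Q[OF that] False ball_subset_cball bump_nonneg[of c r x] 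
        by (smt (verit) subset_iff)
      then have "(\<Sum>(c, r)\<in>I n. bump c r x) = 0" by (auto intro!: sum.neutral)
      then show ?thesis by (simp add: soft_indicator_def)
    qed
    then show ?thesis using False by simp
  qed
  have \<Omega>s: "\<Omega> \<in> sets lebesgue" using \<Omega> by auto
  have [measurable]: "f \<in> borel_measurable (lebesgue_on \<Omega>)" using f by auto
  have [measurable]: "soft_indicator (I n) (real n) \<in> borel_measurable (lebesgue_on \<Omega>)" for n
    using C1c_continuous[OF C1] \<Omega>s by (rule continuous_borel_measurable_lebesgue_on)
  have [measurable]: "U \<in> sets (lebesgue_on \<Omega>)"
    using U \<Omega>s by (auto simp: sets_restrict_space)
  have "(\<lambda>n. integral\<^sup>L (lebesgue_on \<Omega>) (\<lambda>x. soft_indicator (I n) (real n) x * f x))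
     \<longlonglongrightarrow> integral\<^sup>L (lebesgue_on \<Omega>) (\<lambda>x. indicator U x * f x)"
  proof (rule integral_dominated_convergence[where w="\<lambda>x. \<bar>f x\<bar>"])
    show "integrable (lebesgue_on \<Omega>) (\<lambda>x. \<bar>f x\<bar>)" using f by simp
    show "AE x in lebesgue_on \<Omega>. (\<lambda>n. soft_indicator (I n) (real n) x * f x) \<longlonglongrightarrow> indicator U x * f x"
      by (intro AE_I2 tendsto_mult lim tendsto_const)
    show "AE x in lebesgue_on \<Omega>. norm (soft_indicator (I n) (real n) x * f x) \<le> \<bar>f x\<bar>" for n
      using soft_indicator_bounds[of "real n" "I n"]
      by (intro AE_I2) (auto simp: abs_mult intro!: mult_left_le_one_le)
  qed measurable
  then show ?thesis
    by (simp add: zero[OF C1] LIMSEQ_const_iff)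
qed simp

lemma fundamental_lemma:
  fixes f :: "'a::euclidean_space \<Rightarrow> real"
  assumes op: "open \<Omega>" and \<Omega>: "\<Omega> \<in> lmeasurable" and f: "integrable (lebesgue_on \<Omega>) f"
    and zero: "\<And>\<eta>. \<eta> \<in> C1c \<Omega> \<Longrightarrow> integral\<^sup>L (lebesgue_on \<Omega>) (\<lambda>x. \<eta> x * f x) = 0"
  shows "AE x in lebesgue_on \<Omega>. f x = 0"
proof -
  let ?L = "lebesgue_on \<Omega>"
  have \<Omega>s: "\<Omega> \<in> sets lebesgue" using \<Omega> by auto
  have sub: "A \<inter> \<Omega> \<in> sets ?L" if "A \<in> sets lebesgue" for A
    using that \<Omega>s by (auto simp: sets_restrict_space)
  have borel: "(LINT x:(A \<inter> \<Omega>)|?L. f x) = 0" if "A \<in> sigma_sets UNIV {S::'a set. open S}" for A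
  proof -
    have "Int_stable {S::'a set. open S}" by (auto simp: Int_stable_def)
    moreover have "{S::'a set. open S} \<subseteq> Pow UNIV" by simp
    ultimately show ?thesis using that
    proof (induction A rule: sigma_sets_induct_disjoint)
      case (basic A)
      then show ?case
        using fundamental_lemma_open[OF \<Omega> f zero, of "A \<inter> \<Omega>"] op
        by (simp add: set_lebesgue_integral_def open_Int)
    next
      case empty
      show ?case by (simp add: set_lebesgue_integral_def)
    next
      case (compl A)
      have A: "A \<in> sets lebesgue" 
        using compl(1) by (auto simp: borel_def intro!: sets_completionI_sets)
      have A': "UNIV - A \<in> sets lebesgue"
        using A using sets.compl_sets[of A lebesgue] by simp
      have 1: "set_integrable ?L (A \<inter> \<Omega>) f" "set_integrable ?L ((UNIV - A) \<inter> \<Omega>) f"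
        using sub[OF A] sub[OF A'] f
        unfolding set_integrable_def by (intro integrable_mult_indicator; simp)+
      have "(LINT x:(A \<inter> \<Omega>) \<union> ((UNIV - A) \<inter> \<Omega>)|?L. f x) = (LINT x:(A \<inter> \<Omega>)|?L. f x) + (LINT x:((UNIV - A) \<inter> \<Omega>)|?L. f x)"
        using 1 by (intro set_integral_Un) auto
      moreover have "(A \<inter> \<Omega>) \<union> ((UNIV - A) \<inter> \<Omega>) = \<Omega>" by blast
      \<comment> \<open>\<Omega> is itself open, so the total integral vanishes and the complement
        inherits the value 0.\<close>
      moreover have "(LINT x:\<Omega>|?L. f x) = 0"
        using fundamental_lemma_open[OF \<Omega> f zero op] by (simp add: set_lebesgue_integral_def)
      ultimately show ?case using compl by simp
    next
      case (union A)
      have A: "A i \<in> sets lebesgue" for i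
        using range_subsetD[OF union(2), of i] by (auto simp: borel_def intro!: sets_completionI_sets)
      have e: "(\<Union>i. A i) \<inter> \<Omega> = (\<Union>i. A i \<inter> \<Omega>)" by blast
      have "(LINT x:(\<Union>i. A i \<inter> \<Omega>)|?L. f x) = (\<Sum>i. (LINT x:(A i \<inter> \<Omega>)|?L. f x))"
      proof (rule lebesgue_integral_countable_add)
        show "A i \<inter> \<Omega> \<in> sets ?L" for i using sub A by blast
        show "i \<noteq> j \<Longrightarrow> A i \<inter> \<Omega> \<inter> (A j \<inter> \<Omega>) = {}" for i j
          using union(1) by (auto simp: disjoint_family_on_def)
        show "set_integrable ?L (\<Union>i. A i \<inter> \<Omega>) f"
          using f sub A unfolding set_integrable_def by (intro integrable_mult_indicator) auto
      qed
      then show ?case unfolding e using union(3) by simp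
    qed
  qed
  interpret finite_measure ?L using \<Omega> by (rule finite_measure_lebesgue_on)
  show ?thesis
  proof (rule density_zero[OF f])
    fix A assume "A \<in> sets ?L"
    then have A: "A \<in> sets lebesgue" "A \<subseteq> \<Omega>" using \<Omega>s by (auto simp: sets_restrict_space)
    \<comment> \<open>The Dynkin argument reaches Borel sets only. A Lebesgue set differs from a
      Borel set by part of a null set, which the integral does not see.\<close>
    obtain S N N' where S: "A = S \<union> N" "N \<subseteq> N'" "N' \<in> null_sets lborel" "S \<in> sets lborel"
      using A(1) by (rule sets_completionE)
    have N': "N' \<in> null_sets lebesgue" using S(3) by (rule null_sets_completionI)
    then have "AE x in lebesgue. x \<notin> N'" by (rule AE_not_in)
    then have "AE x in ?L. x \<notin> N'" 
      using \<Omega>s by (subst AE_restrict_space_iff) auto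
    then have "AE x in ?L. indicator A x *\<^sub>R f x = indicator (S \<inter> \<Omega>) x *\<^sub>R f x"
      by eventually_elim (use S A in \<open>auto simp: indicator_def\<close>)
    moreover have "A \<in> sets ?L" "S \<inter> \<Omega> \<in> sets ?L"
      using A S sub[of A] sub[of S] by (auto simp: Int_absorb2 sets_completionI_sets)
    ultimately have "(LINT x:A|?L. f x) = (LINT x:S \<inter> \<Omega>|?L. f x)"
      using f unfolding set_lebesgue_integral_def
      by (intro integral_cong_AE borel_measurable_scaleR) auto
    also have "\<dots> = 0" using S(4) by (intro borel) (simp add: borel_def)
    finally show "(LINT x:A|?L. f x) = 0" .
  qed
qed

section \<open>Square-integrable functions and weak gradients\<close>

lemma L2_dominated:
  fixes f :: "'a::euclidean_space \<Rightarrow> 'b::real_inner" and g :: "'a \<Rightarrow> 'c::real_inner"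
  assumes "f \<in> L2 \<Omega>" "g \<in> borel_measurable (lebesgue_on \<Omega>)" "\<And>x. x \<in> \<Omega> \<Longrightarrow> norm (g x) \<le> norm (f x)"
  shows "g \<in> L2 \<Omega>"
proof -
  have "integrable (lebesgue_on \<Omega>) (\<lambda>x. (norm (g x))\<^sup>2)"
  proof (rule Bochner_Integration.integrable_bound)
    show "integrable (lebesgue_on \<Omega>) (\<lambda>x. (norm (f x))\<^sup>2)" using assms(1) by (simp add: L2_def)
    show "(\<lambda>x. (norm (g x))\<^sup>2) \<in> borel_measurable (lebesgue_on \<Omega>)" using assms(2) by measurable
    show "AE x in lebesgue_on \<Omega>. norm ((norm (g x))\<^sup>2) \<le> norm ((norm (f x))\<^sup>2)"
      using assms(3) by (intro AE_I2) (auto intro!: power_mono)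
  qed
  then show ?thesis using assms(2) by (simp add: L2_def)
qed

lemma L2_bounded:
  fixes f :: "'a::euclidean_space \<Rightarrow> 'b::euclidean_space"
  assumes "\<Omega> \<in> lmeasurable" "f \<in> borel_measurable (lebesgue_on \<Omega>)" "\<And>x. x \<in> \<Omega> \<Longrightarrow> norm (f x) \<le> B"
  shows "f \<in> L2 \<Omega>"
proof -
  interpret finite_measure "lebesgue_on \<Omega>" using assms(1) by (rule finite_measure_lebesgue_on)
  have "(\<lambda>x. B) \<in> L2 \<Omega>" by (simp add: L2_def)
  then show ?thesis
    by (rule L2_dominated) (use assms in \<open>auto intro: order_trans[OF _ abs_ge_self]\<close>)
qed

lemma L2_lincomb:
  fixes f g :: "'a::euclidean_space \<Rightarrow> 'b::euclidean_space"
  assumes "f \<in> L2 \<Omega>" "g \<in> L2 \<Omega>"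
  shows "(\<lambda>x. a *\<^sub>R f x + b *\<^sub>R g x) \<in> L2 \<Omega>"
proof -
  have [measurable]: "f \<in> borel_measurable (lebesgue_on \<Omega>)" "g \<in> borel_measurable (lebesgue_on \<Omega>)"
    using assms by (auto simp: L2_def)
  have "integrable (lebesgue_on \<Omega>) (\<lambda>x. (norm (a *\<^sub>R f x + b *\<^sub>R g x))\<^sup>2)"
  proof (rule Bochner_Integration.integrable_bound)
    show "integrable (lebesgue_on \<Omega>) (\<lambda>x. 2 * a\<^sup>2 * (norm (f x))\<^sup>2 + 2 * b\<^sup>2 * (norm (g x))\<^sup>2)"
      using assms by (auto simp: L2_def)
    have le: "\<bar>(norm (a *\<^sub>R f x + b *\<^sub>R g x))\<^sup>2\<bar> \<le> 2 * a\<^sup>2 * (norm (f x))\<^sup>2 + 2 * b\<^sup>2 * (norm (g x))\<^sup>2" for x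
    proof -
      have "(norm (a *\<^sub>R f x + b *\<^sub>R g x))\<^sup>2 \<le> (\<bar>a\<bar> * norm (f x) + \<bar>b\<bar> * norm (g x))\<^sup>2"
        by (intro power_mono norm_triangle_le) auto
      also have "\<dots> \<le> 2 * (\<bar>a\<bar> * norm (f x))\<^sup>2 + 2 * (\<bar>b\<bar> * norm (g x))\<^sup>2"
        using sum_squares_bound[of "\<bar>a\<bar> * norm (f x)" "\<bar>b\<bar> * norm (g x)"] by (simp add: power2_sum)
      finally show ?thesis by (simp add: power_mult_distrib)
    qed
    show "AE x in lebesgue_on \<Omega>. norm ((norm (a *\<^sub>R f x + b *\<^sub>R g x))\<^sup>2) 
        \<le> norm (2 * a\<^sup>2 * (norm (f x))\<^sup>2 + 2 * b\<^sup>2 * (norm (g x))\<^sup>2)"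
      by (rule AE_I2) (unfold real_norm_def, rule order_trans[OF le abs_ge_self])
  qed measurable
  then show ?thesis by (simp add: L2_def)
qed

lemma L2_scaleR: "(f :: 'a::euclidean_space \<Rightarrow> 'b::euclidean_space) \<in> L2 \<Omega> \<Longrightarrow> (\<lambda>x. c *\<^sub>R f x) \<in> L2 \<Omega>"
  using L2_lincomb[of f \<Omega> f c 0] by simp

lemma L2_sum:
  fixes f :: "'i \<Rightarrow> 'a::euclidean_space \<Rightarrow> 'b::euclidean_space"
  assumes "finite I" "\<And>i. i \<in> I \<Longrightarrow> f i \<in> L2 \<Omega>"
  shows "(\<lambda>x. \<Sum>i\<in>I. f i x) \<in> L2 \<Omega>"
  using assms
proof (induction I rule: finite_induct)
  case empty
  show ?case by (simp add: L2_def)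
next
  case (insert i I)
  then show ?case using L2_lincomb[of "f i" \<Omega> "\<lambda>x. \<Sum>i\<in>I. f i x" 1 1] by simp
qed

lemma L2_bounded_linear:
  fixes f :: "'a::euclidean_space \<Rightarrow> 'b::euclidean_space" and T :: "'b \<Rightarrow> 'c::euclidean_space"
  assumes T: "linear T" and f: "f \<in> L2 \<Omega>"
  shows "(\<lambda>x. T (f x)) \<in> L2 \<Omega>"
proof -
  obtain B where B: "\<And>y. norm (T y) \<le> B * norm y" using linear_bounded[OF T] by blast
  have "(\<lambda>x. B *\<^sub>R f x) \<in> L2 \<Omega>" using f by (rule L2_scaleR)
  moreover have "continuous_on UNIV T" using T by (simp add: linear_continuous_on linear_linear)
  then have "(\<lambda>x. T (f x)) \<in> borel_measurable (lebesgue_on \<Omega>)"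
    using f by (auto simp: L2_def intro: borel_measurable_continuous_on)
  ultimately show ?thesis
    by (rule L2_dominated) (simp, rule order_trans[OF B], rule mult_right_mono, auto)
qed

lemma L2_scaleR_bounded:
  fixes m :: "'a::euclidean_space \<Rightarrow> real" and f :: "'a \<Rightarrow> 'b::euclidean_space"
  assumes m: "m \<in> borel_measurable (lebesgue_on \<Omega>)" "\<And>x. x \<in> \<Omega> \<Longrightarrow> \<bar>m x\<bar> \<le> B" and f: "f \<in> L2 \<Omega>"
  shows "(\<lambda>x. m x *\<^sub>R f x) \<in> L2 \<Omega>"
proof (rule L2_dominated[OF L2_scaleR[OF f, of B]])
  have [measurable]: "f \<in> borel_measurable (lebesgue_on \<Omega>)" using f by (simp add: L2_def)
  show "(\<lambda>x. m x *\<^sub>R f x) \<in> borel_measurable (lebesgue_on \<Omega>)" using m(1) by measurable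
  show "norm (m x *\<^sub>R f x) \<le> norm (B *\<^sub>R f x)" if "x \<in> \<Omega>" for x
    using m(2)[OF that] by (auto intro: mult_right_mono)
qed

lemma integrable_L2_inner:
  fixes f g :: "'a::euclidean_space \<Rightarrow> 'b::euclidean_space"
  assumes "f \<in> L2 \<Omega>" "g \<in> L2 \<Omega>"
  shows "integrable (lebesgue_on \<Omega>) (\<lambda>x. f x \<bullet> g x)"
proof (rule Bochner_Integration.integrable_bound)
  have [measurable]: "f \<in> borel_measurable (lebesgue_on \<Omega>)" "g \<in> borel_measurable (lebesgue_on \<Omega>)"
    using assms by (auto simp: L2_def)
  show "integrable (lebesgue_on \<Omega>) (\<lambda>x. (norm (f x))\<^sup>2 + (norm (g x))\<^sup>2)"
    using assms by (auto simp: L2_def)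
  show "(\<lambda>x. f x \<bullet> g x) \<in> borel_measurable (lebesgue_on \<Omega>)" by measurable
  have le: "\<bar>f x \<bullet> g x\<bar> \<le> (norm (f x))\<^sup>2 + (norm (g x))\<^sup>2" for x
  proof -
    have "\<bar>f x \<bullet> g x\<bar> \<le> norm (f x) * norm (g x)" by (rule Cauchy_Schwarz_ineq2)
    also have "\<dots> \<le> (norm (f x))\<^sup>2 + (norm (g x))\<^sup>2"
      using sum_squares_bound[of "norm (f x)" "norm (g x)"]
        mult_nonneg_nonneg[OF norm_ge_zero[of "f x"] norm_ge_zero[of "g x"]] by linarith
    finally show ?thesis .
  qed
  show "AE x in lebesgue_on \<Omega>. norm (f x \<bullet> g x) \<le> norm ((norm (f x))\<^sup>2 + (norm (g x))\<^sup>2)"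
    by (rule AE_I2) (unfold real_norm_def, rule order_trans[OF le abs_ge_self])
qed

text \<open>On a set of finite measure constants are square-integrable, so each coordinate of
  \<open>f\<close> is the integrand of an L2 pairing with a constant basis vector.\<close>

lemma integrable_L2:
  fixes f :: "'a::euclidean_space \<Rightarrow> 'b::euclidean_space"
  assumes "\<Omega> \<in> lmeasurable" "f \<in> L2 \<Omega>"
  shows "integrable (lebesgue_on \<Omega>) f"
proof -
  have const: "(\<lambda>x. b) \<in> L2 \<Omega>" for b :: 'b using assms(1) by (rule L2_bounded) auto
  have "integrable (lebesgue_on \<Omega>) (\<lambda>x. \<Sum>b\<in>Basis. (f x \<bullet> b) *\<^sub>R b)"
    by (intro Bochner_Integration.integrable_sum integrable_scaleR_left integrable_L2_inner assms(2) const)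
  then show ?thesis by (simp add: euclidean_representation)
qed

section \<open>Weak gradients: uniqueness, linearity and constants\<close>

lemma weak_gradient_grad: "v \<in> H1 \<Omega> \<Longrightarrow> weak_gradient \<Omega> v (grad \<Omega> v)"
  using someI_ex[of "weak_gradient \<Omega> v"] by (auto simp: H1_def grad_def)

lemma grad_L2: "v \<in> H1 \<Omega> \<Longrightarrow> grad \<Omega> v \<in> L2 \<Omega>"
  using weak_gradient_grad by (auto simp: weak_gradient_def)

lemma H1_L2: "v \<in> H1 \<Omega> \<Longrightarrow> v \<in> L2 \<Omega>"
  by (simp add: H1_def)

context
  fixes \<Omega> :: "'a::euclidean_space set"
  assumes op: "open \<Omega>" and bdd: "bounded \<Omega>"
begin

lemma lmeasurable_domain: "\<Omega> \<in> lmeasurable"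
  using op bdd by (rule lmeasurable_open[rotated])

lemma C1c_measurable:
  assumes "\<eta> \<in> C1c \<Omega>"
  shows "\<eta> \<in> borel_measurable (lebesgue_on \<Omega>)" "gradient \<eta> \<in> borel_measurable (lebesgue_on \<Omega>)"
  using C1c_continuous[OF assms] C1c_gradient(2)[OF assms] op
  by (auto intro!: continuous_borel_measurable_lebesgue_on)

lemma integrable_C1c_scaleR:
  fixes g :: "'a \<Rightarrow> 'b::euclidean_space"
  assumes "\<eta> \<in> C1c \<Omega>" "g \<in> L2 \<Omega>"
  shows "integrable (lebesgue_on \<Omega>) (\<lambda>x. \<eta> x *\<^sub>R g x)"
proof -
  obtain B where "\<And>x. \<bar>\<eta> x\<bar> \<le> B" using C1c_bounded[OF assms(1)] by metis
  then show ?thesis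
    by (intro integrable_L2[OF lmeasurable_domain] L2_scaleR_bounded C1c_measurable assms)
qed

lemma integrable_scaleR_gradient:
  fixes v :: "'a \<Rightarrow> real"
  assumes "\<eta> \<in> C1c \<Omega>" "v \<in> L2 \<Omega>"
  shows "integrable (lebesgue_on \<Omega>) (\<lambda>x. v x *\<^sub>R gradient \<eta> x)"
proof (rule integrable_L2[OF lmeasurable_domain])
  obtain B where B: "\<And>x. norm (gradient \<eta> x) \<le> B" using C1c_bounded[OF assms(1)] by metis
  have [measurable]: "v \<in> borel_measurable (lebesgue_on \<Omega>)" "gradient \<eta> \<in> borel_measurable (lebesgue_on \<Omega>)"
    using assms C1c_measurable by (auto simp: L2_def)
  show "(\<lambda>x. v x *\<^sub>R gradient \<eta> x) \<in> L2 \<Omega>"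
  proof (rule L2_dominated[OF L2_scaleR[OF assms(2), of B]])
    show "norm (v x *\<^sub>R gradient \<eta> x) \<le> norm (B *\<^sub>R v x)" for x
      using B[of x] by (auto simp: abs_mult mult.commute[of B] mult.commute[of "\<bar>B\<bar>"] 
          intro!: mult_left_mono)
  qed measurable
qed

text \<open>The difference of two weak gradients is annihilated by all test functions. The
  fundamental lemma is scalar, so it is applied in each coordinate and the finitely many null sets
  are united.\<close>

lemma weak_gradient_unique:
  assumes g: "weak_gradient \<Omega> v g" and h: "weak_gradient \<Omega> v h"
  shows "AE x in lebesgue_on \<Omega>. g x = h x"
proof -
  have L2: "g \<in> L2 \<Omega>" "h \<in> L2 \<Omega>" using g h by (auto simp: weak_gradient_def)
  have d: "(\<lambda>x. g x - h x) \<in> L2 \<Omega>" using L2_lincomb[OF L2, of 1 "-1"] by simp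
  have "AE x in lebesgue_on \<Omega>. (g x - h x) \<bullet> b = 0" if "b \<in> Basis" for b
  proof (rule fundamental_lemma[OF op lmeasurable_domain])
    have "integrable (lebesgue_on \<Omega>) (\<lambda>x. g x - h x)"
      using lmeasurable_domain d by (rule integrable_L2)
    then show "integrable (lebesgue_on \<Omega>) (\<lambda>x. (g x - h x) \<bullet> b)"
      by (rule integrable_inner_left)
    fix \<eta> assume \<eta>: "\<eta> \<in> C1c \<Omega>"
    have "integral\<^sup>L (lebesgue_on \<Omega>) (\<lambda>x. \<eta> x *\<^sub>R g x) = integral\<^sup>L (lebesgue_on \<Omega>) (\<lambda>x. \<eta> x *\<^sub>R h x)"
      using g h \<eta> unfolding weak_gradient_def by (metis neg_equal_iff_equal)
    then have "integral\<^sup>L (lebesgue_on \<Omega>) (\<lambda>x. \<eta> x *\<^sub>R (g x - h x)) = 0"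
      using integrable_C1c_scaleR[OF \<eta> L2(1)] integrable_C1c_scaleR[OF \<eta> L2(2)]
      by (simp add: scaleR_diff_right)
    then have "integral\<^sup>L (lebesgue_on \<Omega>) (\<lambda>x. (\<eta> x *\<^sub>R (g x - h x)) \<bullet> b) = 0"
      using integral_inner_left[of b "lebesgue_on \<Omega>" "\<lambda>x. \<eta> x *\<^sub>R (g x - h x)"] integrable_C1c_scaleR[OF \<eta> d]
      by simp
    then show "integral\<^sup>L (lebesgue_on \<Omega>) (\<lambda>x. \<eta> x * ((g x - h x) \<bullet> b)) = 0"
      by simp
  qed
  then have "AE x in lebesgue_on \<Omega>. \<forall>b\<in>Basis. (g x - h x) \<bullet> b = 0"
    by (subst AE_finite_all) auto
  then show ?thesis
    by eventually_elim (metis euclidean_all_zero_iff right_minus_eq)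
qed

lemma weak_gradient_lincomb:
  assumes L2: "v \<in> L2 \<Omega>" "w \<in> L2 \<Omega>" and g: "weak_gradient \<Omega> v g" and h: "weak_gradient \<Omega> w h"
  shows "weak_gradient \<Omega> (\<lambda>x. a * v x + b * w x) (\<lambda>x. a *\<^sub>R g x + b *\<^sub>R h x)"
proof -
  have gh: "g \<in> L2 \<Omega>" "h \<in> L2 \<Omega>" using g h by (auto simp: weak_gradient_def)
  have "integral\<^sup>L (lebesgue_on \<Omega>) (\<lambda>x. (a * v x + b * w x) *\<^sub>R gradient \<eta> x) =
      - integral\<^sup>L (lebesgue_on \<Omega>) (\<lambda>x. \<eta> x *\<^sub>R (a *\<^sub>R g x + b *\<^sub>R h x))" if \<eta>: "\<eta> \<in> C1c \<Omega>" for \<eta>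
  proof -
    note i = integrable_C1c_scaleR[OF \<eta> gh(1)] integrable_C1c_scaleR[OF \<eta> gh(2)]
      integrable_scaleR_gradient[OF \<eta> L2(1)] integrable_scaleR_gradient[OF \<eta> L2(2)]
    have "(\<lambda>x. \<eta> x *\<^sub>R (a *\<^sub>R g x + b *\<^sub>R h x)) = (\<lambda>x. a *\<^sub>R (\<eta> x *\<^sub>R g x) + b *\<^sub>R (\<eta> x *\<^sub>R h x))"
      by (simp add: scaleR_add_right mult.commute)
    moreover have "(\<lambda>x. (a * v x + b * w x) *\<^sub>R gradient \<eta> x) 
        = (\<lambda>x. a *\<^sub>R (v x *\<^sub>R gradient \<eta> x) + b *\<^sub>R (w x *\<^sub>R gradient \<eta> x))"
      by (simp add: scaleR_add_left)
    ultimately show ?thesis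
      using i g h \<eta> by (simp add: weak_gradient_def del: scaleR_scaleR)
  qed
  then show ?thesis using L2_lincomb[OF gh] by (simp add: weak_gradient_def)
qed

lemma H1_lincomb:
  assumes "v \<in> H1 \<Omega>" "w \<in> H1 \<Omega>"
  shows "(\<lambda>x. a * v x + b * w x) \<in> H1 \<Omega>"
  using weak_gradient_lincomb[OF assms[THEN H1_L2] assms[THEN weak_gradient_grad]] 
    L2_lincomb[OF assms[THEN H1_L2]]
  by (auto simp: H1_def)

lemma grad_lincomb:
  assumes "v \<in> H1 \<Omega>" "w \<in> H1 \<Omega>"
  shows "AE x in lebesgue_on \<Omega>. 
    grad \<Omega> (\<lambda>x. a * v x + b * w x) x = a *\<^sub>R grad \<Omega> v x + b *\<^sub>R grad \<Omega> w x"
  using weak_gradient_grad[OF H1_lincomb[OF assms]]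
    weak_gradient_lincomb[OF assms[THEN H1_L2] assms[THEN weak_gradient_grad]]
  by (rule weak_gradient_unique)

text \<open>By translation invariance, the integrals of the difference quotients of \<open>\<eta>\<close> vanish.\<close>

lemma integral_gradient_C1c:
  assumes \<eta>: "\<eta> \<in> C1c \<Omega>"
  shows "integral\<^sup>L (lebesgue_on \<Omega>) (gradient \<eta>) = 0"
proof -
  obtain K where K: "compact K" "K \<subseteq> \<Omega>" "\<And>x. x \<notin> K \<Longrightarrow> \<eta> x = 0" "\<And>x. x \<notin> K \<Longrightarrow> gradient \<eta> x = 0"
    using C1c_compact_support[OF \<eta>] by metis
  obtain R where R: "\<And>x. x \<in> K \<Longrightarrow> norm x \<le> R" 
    using K(1) compact_imp_bounded bounded_iff by metis
  obtain B where B: "B \<ge> 0" "\<And>x. norm (gradient \<eta> x) \<le> B" using C1c_bounded[OF \<eta>] by metis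
  have cont: "continuous_on UNIV \<eta>" "continuous_on UNIV (gradient \<eta>)"
    using C1c_continuous[OF \<eta>] C1c_gradient(2)[OF \<eta>] by auto
  then have [measurable]: "\<eta> \<in> borel_measurable borel" "gradient \<eta> \<in> borel_measurable borel"
    by (auto intro: borel_measurable_continuous_onI)
  have deriv: "(\<eta> has_derivative (\<lambda>h. h \<bullet> gradient \<eta> x)) (at x)" for x
    using C1c_gradient(1)[OF \<eta>] by (simp add: gderiv_def)
  \<comment> \<open>This Lipschitz bound dominates all difference quotients at once.\<close>
  have lip: "\<bar>\<eta> y - \<eta> x\<bar> \<le> B * norm (y - x)" for x y
  proof -
    have "norm (\<eta> y - \<eta> x) \<le> B * norm (y - x)"
    proof (rule differentiable_bound[where S=UNIV])
      show "onorm (\<lambda>h. h \<bullet> gradient \<eta> x) \<le> B" for x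
        using B by (intro onorm_bound) (auto intro!: order_trans[OF Cauchy_Schwarz_ineq2] 
            simp: mult.commute[of B] intro: mult_left_mono)
    qed (use deriv in auto)
    then show ?thesis by simp
  qed
  have int: "integrable lborel \<eta>"
  proof -
    have "integrable lborel (\<lambda>x. indicator K x *\<^sub>R \<eta> x)"
      using K(1) cont(1) by (intro borel_integrable_compact) (auto intro: continuous_on_subset)
    moreover have "(\<lambda>x. indicator K x *\<^sub>R \<eta> x) = \<eta>" using K(3) by (auto simp: fun_eq_iff indicator_def)
    ultimately show ?thesis by simp
  qed
  have intg: "integrable lborel (gradient \<eta>)"
  proof -
    have "integrable lborel (\<lambda>x. indicator K x *\<^sub>R gradient \<eta> x)"
      using K(1) cont(2) by (intro borel_integrable_compact) (auto intro: continuous_on_subset)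
    moreover have "(\<lambda>x. indicator K x *\<^sub>R gradient \<eta> x) = gradient \<eta>" using K(4) by (auto simp: fun_eq_iff indicator_def)
    ultimately show ?thesis by simp
  qed
  have "integral\<^sup>L lborel (\<lambda>x. gradient \<eta> x \<bullet> e) = 0" if "e \<in> Basis" for e
  proof -
    \<comment> \<open>The step is 1/(k+1): the shift by one avoids a zero step, and steps of length
      at most 1 keep every quotient supported in the ball of radius R + 1.\<close>
    define q where "q k x = (\<eta> ((1 / real (Suc k)) *\<^sub>R e + x) - \<eta> x) * real (Suc k)" for k x
    have "integral\<^sup>L lborel (q k) = 0" for k
    proof -
      have d: "distr lborel borel ((+) ((1 / real (Suc k)) *\<^sub>R e)) = lborel" by (rule lborel_distr_plus)
      have "integrable lborel (\<lambda>x. \<eta> ((1 / real (Suc k)) *\<^sub>R e + x))"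
        using int by (subst (asm) d[symmetric]) (simp add: integrable_distr_eq)
      moreover have "integral\<^sup>L lborel (\<lambda>x. \<eta> ((1 / real (Suc k)) *\<^sub>R e + x)) = integral\<^sup>L lborel \<eta>"
        by (subst (2) d[symmetric]) (simp add: integral_distr)
      ultimately show ?thesis using int unfolding q_def by simp
    qed
    moreover have "(\<lambda>k. integral\<^sup>L lborel (q k)) \<longlonglongrightarrow> integral\<^sup>L lborel (\<lambda>x. gradient \<eta> x \<bullet> e)"
    proof (rule integral_dominated_convergence[where w="\<lambda>x. indicator (cball 0 (R + 1)) x *\<^sub>R B"])
      show "q k \<in> borel_measurable lborel" for k unfolding q_def by measurable
      show "(\<lambda>x. gradient \<eta> x \<bullet> e) \<in> borel_measurable lborel" by measurable
      show "integrable lborel (\<lambda>x. indicator (cball (0::'a) (R + 1)) x *\<^sub>R B)"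
        by (intro borel_integrable_compact) auto
      show "AE x in lborel. norm (q k x) \<le> indicator (cball 0 (R + 1)) x *\<^sub>R B" for k
      proof (intro AE_I2)
        fix x
        let ?y = "(1 / real (Suc k)) *\<^sub>R e + x"
        have small: "norm ((1 / real (Suc k)) *\<^sub>R e) \<le> 1" using that by simp
        show "norm (q k x) \<le> indicator (cball 0 (R + 1)) x *\<^sub>R B"
        proof (cases "x \<in> cball 0 (R + 1)")
          case True
          have "\<bar>\<eta> ?y - \<eta> x\<bar> \<le> B * (1 / real (Suc k))" using lip[of ?y x] that by simp
          then have "\<bar>\<eta> ?y - \<eta> x\<bar> * real (Suc k) \<le> B" by (simp add: pos_le_divide_eq)
          then show ?thesis using True by (simp add: q_def abs_mult del: of_nat_Suc)
        next
          case False
          then have "norm x > R + 1" by simp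
          then have "x \<notin> K" "?y \<notin> K"
            using R[of x] R[of ?y] norm_triangle_ineq2[of x "- ((1 / real (Suc k)) *\<^sub>R e)"] small
            by (auto simp: add.commute simp del: norm_scaleR)
          then show ?thesis using K(3) False by (simp add: q_def)
        qed
      qed
      show "AE x in lborel. (\<lambda>k. q k x) \<longlonglongrightarrow> gradient \<eta> x \<bullet> e"
      proof (intro AE_I2)
        fix x
        have "((\<lambda>t. \<eta> (t *\<^sub>R e + x)) has_derivative (\<lambda>t. (t *\<^sub>R e) \<bullet> gradient \<eta> x)) (at 0)"
          by (rule has_derivative_compose[of "\<lambda>t. t *\<^sub>R e + x" "\<lambda>t. t *\<^sub>R e" 0 UNIV \<eta>])
            (auto intro!: derivative_eq_intros deriv)
        then have "((\<lambda>t. \<eta> (t *\<^sub>R e + x)) has_real_derivative (gradient \<eta> x \<bullet> e)) (at 0)"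
          by (simp add: has_field_derivative_def inner_commute mult_commute_abs)
        then have "(\<lambda>h. (\<eta> (h *\<^sub>R e + x) - \<eta> x) / h) \<midarrow>0\<rightarrow> gradient \<eta> x \<bullet> e"
          by (simp add: DERIV_def)
        moreover have "filterlim (\<lambda>k. 1 / real (Suc k)) (at 0) sequentially"
          using LIMSEQ_inverse_real_of_nat by (auto simp: filterlim_at inverse_eq_divide)
        ultimately have "(\<lambda>k. (\<eta> ((1 / real (Suc k)) *\<^sub>R e + x) - \<eta> x) / (1 / real (Suc k)))
            \<longlonglongrightarrow> gradient \<eta> x \<bullet> e"
          by (rule filterlim_compose)
        then show "(\<lambda>k. q k x) \<longlonglongrightarrow> gradient \<eta> x \<bullet> e" by (simp add: q_def)
      qed
    qed
    ultimately show ?thesis by (simp add: LIMSEQ_const_iff)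
  qed
  then have "integral\<^sup>L lborel (gradient \<eta>) \<bullet> e = 0" if "e \<in> Basis" for e
    using that intg by simp
  then have "integral\<^sup>L lborel (gradient \<eta>) = 0" using euclidean_all_zero_iff by blast
  \<comment> \<open>Translation invariance was used on \<open>lborel\<close> over the whole space.
    The result passes to \<Omega> because the gradient vanishes outside it, and completing the
    measure does not change the integral of a Borel function.\<close>
  moreover have "integral\<^sup>L (lebesgue_on \<Omega>) (gradient \<eta>) = integral\<^sup>L lebesgue (\<lambda>x. indicator \<Omega> x *\<^sub>R gradient \<eta> x)"
    using op by (intro integral_restrict_space) auto
  moreover have "(\<lambda>x. indicator \<Omega> x *\<^sub>R gradient \<eta> x) = gradient \<eta>"
    using K(2,4) by (auto simp: fun_eq_iff indicator_def)
  moreover have "integral\<^sup>L lebesgue (gradient \<eta>) = integral\<^sup>L lborel (gradient \<eta>)"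
    by (rule integral_completion) measurable
  ultimately show ?thesis by simp
qed

lemma const_H1: "(\<lambda>x. c) \<in> H1 \<Omega>"
proof -
  have "(\<lambda>x. c) \<in> L2 \<Omega>" using lmeasurable_domain by (rule L2_bounded) auto
  moreover have "weak_gradient \<Omega> (\<lambda>x. c) (\<lambda>x. 0)"
    by (auto simp: weak_gradient_def L2_def integral_gradient_C1c)
  ultimately show ?thesis by (auto simp: H1_def)
qed

end

section \<open>Finite element functions and the partial derivatives of the energy\<close>

text \<open>The identity for \<open>k\<close> is asked for almost everywhere only, because
  \<open>grad\<close> and \<open>symgrad\<close> are linear only up to null sets. Membership of
  \<open>k\<close> in L2 supplies the measurability used when the integrand is replaced.\<close>

lemma L2_inner_lincomb:
  fixes f g h k :: "'a::euclidean_space \<Rightarrow> 'b::euclidean_space"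
  assumes "f \<in> L2 \<Omega>" "g \<in> L2 \<Omega>" "h \<in> L2 \<Omega>" "k \<in> L2 \<Omega>"
    and "AE x in lebesgue_on \<Omega>. k x = a *\<^sub>R f x + b *\<^sub>R g x"
  shows "L2_inner \<Omega> k h = a * L2_inner \<Omega> f h + b * L2_inner \<Omega> g h"
proof -
  note i = integrable_L2_inner[OF assms(1,3)] integrable_L2_inner[OF assms(2,3)]
  have "L2_inner \<Omega> k h = integral\<^sup>L (lebesgue_on \<Omega>) (\<lambda>x. a * (f x \<bullet> h x) + b * (g x \<bullet> h x))"
    unfolding L2_inner_def
  proof (rule integral_cong_AE)
    show "(\<lambda>x. k x \<bullet> h x) \<in> borel_measurable (lebesgue_on \<Omega>)"
      using integrable_L2_inner[OF assms(4,3)] by auto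
    show "(\<lambda>x. a * (f x \<bullet> h x) + b * (g x \<bullet> h x)) \<in> borel_measurable (lebesgue_on \<Omega>)"
      using i by auto
    show "AE x in lebesgue_on \<Omega>. k x \<bullet> h x = a * (f x \<bullet> h x) + b * (g x \<bullet> h x)"
      using assms(5) by eventually_elim (simp add: inner_add_left)
  qed
  also have "\<dots> = a * L2_inner \<Omega> f h + b * L2_inner \<Omega> g h"
    using i by (simp add: L2_inner_def)
  finally show ?thesis .
qed

lemma symgrad_symmetric: "transpose (symgrad \<Omega> u x) = symgrad \<Omega> u x"
  by (simp add: symgrad_def transpose_def vec_eq_iff add.commute)

lemma linear_transpose: "linear (transpose :: real^'m^'n \<Rightarrow> real^'n^'m)"
  by (rule linearI) (auto simp: transpose_def vec_eq_iff)

lemma linear_axis: "linear (axis i :: 'b::real_vector \<Rightarrow> 'b^'n)"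
  by (rule linearI) (auto simp: axis_def vec_eq_iff)

lemma linear_trace: "linear (trace :: real^'n^'n \<Rightarrow> real)"
  by (rule linearI) (auto simp: trace_def sum.distrib sum_distrib_left)

lemma trace_eq_inner: "trace (A :: real^'n^'n) = mat 1 \<bullet> A"
  by (simp add: trace_def inner_vec_def mat_def if_distrib[of "\<lambda>c. c * _"] cong: if_cong)

text \<open>The linearity statements are made in this space: it is closed under linear combinations
  for reasons that do not involve the mesh, and it contains the discrete displacements.\<close>

definition H1_vec :: "(real^'d) set \<Rightarrow> (real^'d \<Rightarrow> real^'d) set" where
  "H1_vec \<Omega> = {u. \<forall>i. (\<lambda>x. u x $ i) \<in> H1 \<Omega>}"

lemma jacobian_L2: assumes "u \<in> H1_vec \<Omega>" shows "jacobian \<Omega> u \<in> L2 \<Omega>"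
proof -
  \<comment> \<open>The rows of the Jacobian are gradients. Embedding them by \<open>axis\<close>
    and summing keeps square-integrability, by linear images and finite sums.\<close>
  have "(\<lambda>x. \<Sum>i\<in>UNIV. axis i (grad \<Omega> (\<lambda>y. u y $ i) x)) \<in> L2 \<Omega>"
  proof (rule L2_sum)
    show "(\<lambda>x. axis i (grad \<Omega> (\<lambda>y. u y $ i) x)) \<in> L2 \<Omega>" for i
      using assms by (intro L2_bounded_linear[OF linear_axis] grad_L2) (simp add: H1_vec_def)
  qed simp
  moreover have "(\<lambda>x. \<Sum>i\<in>UNIV. axis i (grad \<Omega> (\<lambda>y. u y $ i) x)) = jacobian \<Omega> u"
  proof (rule ext, subst vec_eq_iff, rule allI)
    show "(\<Sum>i\<in>UNIV. axis i (grad \<Omega> (\<lambda>y. u y $ i) x)) $ j = jacobian \<Omega> u x $ j" for x j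
      by (simp add: jacobian_def axis_def)
  qed
  ultimately show ?thesis by simp
qed

lemma symgrad_L2: assumes "u \<in> H1_vec \<Omega>" shows "symgrad \<Omega> u \<in> L2 \<Omega>"
  using L2_scaleR[OF L2_lincomb[OF jacobian_L2[OF assms] 
    L2_bounded_linear[OF linear_transpose jacobian_L2[OF assms]], of 1 1], of "1/2"]
  by (simp add: symgrad_def[abs_def])

lemma V_h_H1: "v \<in> V_h \<Omega> \<T> \<Longrightarrow> v \<in> H1 \<Omega>"
  by (simp add: V_h_def)

lemma V_h_L2: "v \<in> V_h \<Omega> \<T> \<Longrightarrow> v \<in> L2 \<Omega>"
  by (simp add: V_h_def H1_def)

lemma V_h_measurable: "v \<in> V_h \<Omega> \<T> \<Longrightarrow> v \<in> borel_measurable (lebesgue_on \<Omega>)"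
  using V_h_L2 by (auto simp: L2_def)

lemma X_h_vec_H1: "u \<in> X_h_vec \<Omega> \<T> \<Longrightarrow> u \<in> H1_vec \<Omega>"
  by (auto simp: X_h_vec_def X_h_def V_h_def H1_vec_def)

context
  fixes \<Omega> :: "(real^'d) set"
  assumes op: "open \<Omega>" and bdd: "bounded \<Omega>"
begin

lemma H1_vec_lincomb:
  assumes "u \<in> H1_vec \<Omega>" "w \<in> H1_vec \<Omega>"
  shows "(\<lambda>x. a *\<^sub>R u x + b *\<^sub>R w x) \<in> H1_vec \<Omega>"
  using assms H1_lincomb[OF op bdd] by (auto simp: H1_vec_def)

lemma symgrad_lincomb:
  assumes "u \<in> H1_vec \<Omega>" "w \<in> H1_vec \<Omega>"
  shows "AE x in lebesgue_on \<Omega>. 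
    symgrad \<Omega> (\<lambda>x. a *\<^sub>R u x + b *\<^sub>R w x) x = a *\<^sub>R symgrad \<Omega> u x + b *\<^sub>R symgrad \<Omega> w x"
proof -
  have "AE x in lebesgue_on \<Omega>. \<forall>i. grad \<Omega> (\<lambda>x. a * u x $ i + b * w x $ i) x 
      = a *\<^sub>R grad \<Omega> (\<lambda>x. u x $ i) x + b *\<^sub>R grad \<Omega> (\<lambda>x. w x $ i) x"
    using assms grad_lincomb[OF op bdd] by (subst AE_all_countable) (auto simp: H1_vec_def)
  then show ?thesis
    by eventually_elim (simp add: symgrad_def jacobian_def transpose_def vec_eq_iff algebra_simps)
qed

lemma V_h_const: "(\<lambda>x. c) \<in> V_h \<Omega> \<T>"
proof -
  have "\<exists>a b. \<forall>x\<in>K. c = a \<bullet> x + b" for K :: "(real^'d) set"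
    by (intro exI[of _ 0] exI[of _ c]) simp
  then show ?thesis using const_H1[OF op bdd] by (simp add: V_h_def)
qed

text \<open>A finite element function is continuous on the compact closure of \<Omega>. This bound
  keeps every continuous coefficient composed with it bounded.\<close>

lemma V_h_bounded:
  assumes "v \<in> V_h \<Omega> \<T>"
  obtains R where "\<And>x. x \<in> \<Omega> \<Longrightarrow> \<bar>v x\<bar> \<le> R"
proof -
  have "compact (v ` closure \<Omega>)"
    using assms bdd by (intro compact_continuous_image) (auto simp: V_h_def)
  then obtain R where "\<And>x. x \<in> closure \<Omega> \<Longrightarrow> \<bar>v x\<bar> \<le> R"
    using compact_imp_bounded by (fastforce simp: bounded_iff)
  then show ?thesis using that closure_subset by blast
qed

lemma X_h_vec_zero: "(\<lambda>x. 0) \<in> X_h_vec \<Omega> \<T>"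
  using V_h_const by (auto simp: X_h_vec_def X_h_def)

end

section \<open>Coefficients composed with bounded functions, and derivatives of the energy\<close>

lemma C2_funD:
  assumes "C2_fun f"
  shows "(f has_vector_derivative vderiv f x) (at x)" "continuous_on UNIV f" "continuous_on UNIV (vderiv f)"
proof -
  obtain D where D: "\<And>x. (f has_vector_derivative D x) (at x)"
    using assms by (auto simp: C2_fun_def C1_differentiable_on_def)
  then have "vderiv f = D" by (auto simp: vderiv_def intro!: ext vector_derivative_at)
  then show "(f has_vector_derivative vderiv f x) (at x)" using D by simp
  show "continuous_on UNIV f"
    using D by (intro continuous_at_imp_continuous_on ballI has_vector_derivative_continuous)
  obtain D' where D': "\<And>x. (vderiv f has_vector_derivative D' x) (at x)"
    using assms by (auto simp: C2_fun_def C1_differentiable_on_def)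
  then show "continuous_on UNIV (vderiv f)"
    by (intro continuous_at_imp_continuous_on ballI has_vector_derivative_continuous)
qed

text \<open>The Riesz representative of the functional \<open>L\<close> is
  \<open>adjoint L 1\<close>. In this form a gradient can be tested without an explicit formula for
  it.\<close>

lemma gradient_inner:
  fixes f :: "'a::euclidean_space \<Rightarrow> real"
  assumes "(f has_derivative L) (at x)"
  shows "gradient f x \<bullet> h = L h"
proof -
  have lin: "linear L" using assms by (rule has_derivative_linear)
  have L: "L = (\<lambda>h. h \<bullet> adjoint L 1)"
    using adjoint_works[OF lin, of _ 1] by auto
  have "GDERIV f x :> adjoint L 1" unfolding gderiv_def using assms L by simp
  then have "gradient f x = adjoint L 1" by (rule gradient_eqI)
  then show ?thesis by (metis L inner_commute)
qed

lemma continuous_on_blinfun_at: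
  fixes C :: "real \<Rightarrow> 'a::real_normed_vector \<Rightarrow>\<^sub>L 'b::real_normed_vector"
  assumes "continuous_on UNIV C" "continuous_on S f" "continuous_on S g"
  shows "continuous_on S (\<lambda>x. C (f x) (g x))"
  by (intro bounded_bilinear.continuous_on[OF bounded_bilinear_blinfun_apply] assms(3)
      continuous_on_compose2[OF assms(1,2)]) auto

lemma bounded_comp:
  fixes f :: "real \<Rightarrow> 'b::real_normed_vector"
  assumes "continuous_on UNIV f" "\<And>x. x \<in> \<Omega> \<Longrightarrow> \<bar>v x\<bar> \<le> R"
  obtains B where "\<And>x. x \<in> \<Omega> \<Longrightarrow> norm (f (v x)) \<le> B"
proof -
  have "compact (f ` {-R..R})"
    using assms(1) by (intro compact_continuous_image) (auto intro: continuous_on_subset)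
  then obtain B where "\<And>y. y \<in> {-R..R} \<Longrightarrow> norm (f y) \<le> B"
    using compact_imp_bounded by (fastforce simp: bounded_iff)
  moreover have "v x \<in> {-R..R}" if "x \<in> \<Omega>" for x using assms(2)[OF that] by auto
  ultimately show ?thesis using that by blast
qed

text \<open>Continuity of \<open>C\<close> serves twice: it bounds the operator norm along the
  bounded \<open>v\<close>, and it makes (y, X) -> C(y) X jointly continuous, which yields
  measurability.\<close>

lemma L2_tensor:
  fixes C :: "real \<Rightarrow> 'b::euclidean_space \<Rightarrow>\<^sub>L 'c::euclidean_space" and v :: "'a::euclidean_space \<Rightarrow> real"
  assumes C: "continuous_on UNIV C" and v: "v \<in> borel_measurable (lebesgue_on \<Omega>)" "\<And>x. x \<in> \<Omega> \<Longrightarrow> \<bar>v x\<bar> \<le> R"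
    and G: "G \<in> L2 \<Omega>"
  shows "(\<lambda>x. C (v x) (G x)) \<in> L2 \<Omega>"
proof -
  obtain B where B: "\<And>x. x \<in> \<Omega> \<Longrightarrow> norm (C (v x)) \<le> B" 
    using bounded_comp[OF C, of \<Omega> v R] v(2) by blast
  show ?thesis
  proof (rule L2_dominated[OF L2_scaleR[OF G, of B]])
    have "continuous_on UNIV (\<lambda>p. C (fst p) (snd p))"
      by (intro continuous_on_blinfun_at C continuous_intros)
    moreover have "(\<lambda>x. (v x, G x)) \<in> borel_measurable (lebesgue_on \<Omega>)"
      using v G by (intro borel_measurable_Pair) (auto simp: L2_def)
    ultimately show "(\<lambda>x. C (v x) (G x)) \<in> borel_measurable (lebesgue_on \<Omega>)"
      by (auto dest: borel_measurable_continuous_on)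
    fix x assume "x \<in> \<Omega>"
    have "norm (C (v x) (G x)) \<le> norm (C (v x)) * norm (G x)" by (rule norm_blinfun)
    also have "\<dots> \<le> \<bar>B\<bar> * norm (G x)"
      using B[OF \<open>x \<in> \<Omega>\<close>] by (intro mult_right_mono) auto
    finally show "norm (C (v x) (G x)) \<le> norm (B *\<^sub>R G x)" by simp
  qed
qed

lemma measurable_comp_continuous:
  fixes f :: "real \<Rightarrow> 'b::euclidean_space"
  assumes "continuous_on UNIV f" "v \<in> borel_measurable M"
  shows "(\<lambda>x. f (v x)) \<in> borel_measurable M"
  using assms by (rule borel_measurable_continuous_on)

text \<open>The part of the stress that is linear in \<open>(G, \<theta>)\<close>: the elastic
  stress minus \<alpha> times the pore pressure M (\<theta> - \<alpha> tr G). The eigenstrain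
  contribution does not contain the unknowns and is left to \<open>first_load\<close>.\<close>

definition stress_lin :: "('d::finite) model \<Rightarrow> real \<Rightarrow> real^'d^'d \<Rightarrow> real \<Rightarrow> real^'d^'d" where
  "stress_lin D x G \<theta> = 2 *\<^sub>R elast D x G
     - (biot_M D x * biot_alpha D x * (\<theta> - biot_alpha D x * trace G)) *\<^sub>R mat 1"

text \<open>On symmetric matrices the symmetry of the tensor makes the adjoint of \<open>elast D x\<close> disappear.\<close>

lemma W_E_inner:
  assumes A3: "assm_A3 D" and G: "transpose G = G" and H: "transpose H = H"
  shows "W_E D x G \<theta> \<bullet> H = (stress_lin D x G \<theta> - 2 *\<^sub>R elast D x (eigenstrain D x)) \<bullet> H"
proof -
  let ?C = "elast D x" and ?T = "eigenstrain D x" and ?a = "biot_alpha D x" and ?M = "biot_M D x"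
  have tr: "(trace has_derivative trace) F" for F :: "(real^'d^'d) filter"
    by (intro bounded_linear_imp_has_derivative linear_linear[THEN iffD2] linear_trace)
  have "((\<lambda>H. W_red D x H \<theta>) has_derivative 
      (\<lambda>H. H \<bullet> ?C (G - ?T) + (G - ?T) \<bullet> ?C H - ?M * (\<theta> - ?a * trace G) * (?a * trace H))) (at G)"
    unfolding W_red_def W_def
    by (auto intro!: derivative_eq_intros tr bounded_linear.has_derivative[OF blinfun.bounded_linear_right])
  then have "W_E D x G \<theta> \<bullet> H = H \<bullet> ?C (G - ?T) + (G - ?T) \<bullet> ?C H - ?M * (\<theta> - ?a * trace G) * (?a * trace H)"
    unfolding W_E_def by (rule gradient_inner)
  moreover have "transpose (G - ?T) = G - ?T"
    using G A3 by (auto simp: assm_A3_def linear_diff[OF linear_transpose])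
  then have "(G - ?T) \<bullet> ?C H = ?C (G - ?T) \<bullet> H"
    using A3 H unfolding assm_A3_def elastic_tensor_def by blast
  ultimately show ?thesis
    by (simp add: stress_lin_def trace_eq_inner blinfun.diff_right inner_diff_left inner_commute algebra_simps)
qed

lemma W_theta_eq: "W_theta D x G \<theta> = biot_M D x * (\<theta> - biot_alpha D x * trace G)"
  unfolding W_theta_def W_red_def
  by (rule DERIV_imp_deriv) (auto intro!: derivative_eq_intros)

section \<open>The first step\<close>

lemma trace_lincomb: "trace (a *\<^sub>R G + b *\<^sub>R H :: real^'n^'n) = a * trace G + b * trace H"
  by (simp add: linear_add[OF linear_trace] linear_cmul[OF linear_trace])

lemma stress_lin_lincomb:
  "stress_lin D x (a *\<^sub>R G + b *\<^sub>R H) (a * \<theta> + b * \<eta>)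
    = a *\<^sub>R stress_lin D x G \<theta> + b *\<^sub>R stress_lin D x H \<eta>"
  by (simp add: stress_lin_def trace_lincomb blinfun.add_right blinfun.scaleR_right algebra_simps)

lemma L2_continuous_coeff:
  fixes f :: "real \<Rightarrow> real" and g :: "'a::euclidean_space \<Rightarrow> 'b::euclidean_space"
  assumes "continuous_on UNIV f" "v \<in> borel_measurable (lebesgue_on \<Omega>)" "\<And>x. x \<in> \<Omega> \<Longrightarrow> \<bar>v x\<bar> \<le> R" "g \<in> L2 \<Omega>"
  shows "(\<lambda>x. f (v x) *\<^sub>R g x) \<in> L2 \<Omega>"
proof -
  obtain B where B: "\<And>x. x \<in> \<Omega> \<Longrightarrow> norm (f (v x)) \<le> B"
    using bounded_comp[OF assms(1), of \<Omega> v R] assms(3) by blast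
  show ?thesis
    by (rule L2_scaleR_bounded[where B=B, OF measurable_comp_continuous[OF assms(1,2)] _ assms(4)])
      (use B in auto)
qed

text \<open>This is the witness for \<open>A\<close> in \<open>linear_system\<close>. The factor
  1/\<tau> stands on the new values alone, since the difference quotients mix the unknown with the
  old values.\<close>

definition first_lin ::
  "(real^'d) set \<Rightarrow> 'd model \<Rightarrow> real \<Rightarrow> (real^'d \<Rightarrow> real) \<Rightarrow>
   (real^'d \<Rightarrow> real^'d) \<times> (real^'d \<Rightarrow> real) \<times> (real^'d \<Rightarrow> real) \<Rightarrow>
   (real^'d \<Rightarrow> real^'d) \<times> (real^'d \<Rightarrow> real) \<times> (real^'d \<Rightarrow> real) \<Rightarrow> real \<times> real \<times> real" where
  "first_lin \<Omega> D \<tau> \<phi>0 = (\<lambda>(u, \<theta>, p) (v, \<zeta>, q).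
     (L2_inner \<Omega> (\<lambda>x. visc D (\<phi>0 x) ((1/\<tau>) *\<^sub>R symgrad \<Omega> u x)
        + stress_lin D (\<phi>0 x) (symgrad \<Omega> u x) (\<theta> x)) (symgrad \<Omega> v),
      L2_inner \<Omega> (\<lambda>x. (1/\<tau>) * \<theta> x) \<zeta> + L2_inner \<Omega> (\<lambda>x. perm D (\<phi>0 x) *\<^sub>R grad \<Omega> p x) (grad \<Omega> \<zeta>),
      L2_inner \<Omega> p q
        - L2_inner \<Omega> (\<lambda>x. biot_M D (\<phi>0 x) * (\<theta> x - biot_alpha D (\<phi>0 x) * trace (symgrad \<Omega> u x))) q))"

text \<open>This is the witness for \<open>b\<close>, which is subtracted; hence the old values of
  the difference quotients appear with a plus sign. The factor 2 comes from differentiating the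
  quadratic form, and the pressure equation contains no data, so its entry is 0.\<close>

definition first_load ::
  "(real^'d) set \<Rightarrow> 'd model \<Rightarrow> real \<Rightarrow> ((real^'d \<Rightarrow> real^'d) \<Rightarrow> real) \<Rightarrow>
   (real^'d \<Rightarrow> real) \<times> (real^'d \<Rightarrow> real^'d) \<times> (real^'d \<Rightarrow> real) \<Rightarrow>
   (real^'d \<Rightarrow> real^'d) \<times> (real^'d \<Rightarrow> real) \<times> (real^'d \<Rightarrow> real) \<Rightarrow> real \<times> real \<times> real" where
  "first_load \<Omega> D \<tau> f1 = (\<lambda>(\<phi>0, u0, \<theta>0) (v, \<zeta>, q).
     (L2_inner \<Omega> (\<lambda>x. visc D (\<phi>0 x) ((1/\<tau>) *\<^sub>R symgrad \<Omega> u0 x)) (symgrad \<Omega> v)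
        + 2 * L2_inner \<Omega> (\<lambda>x. elast D (\<phi>0 x) (eigenstrain D (\<phi>0 x))) (symgrad \<Omega> v) + f1 v,
      L2_inner \<Omega> (\<lambda>x. (1/\<tau>) * \<theta>0 x) \<zeta> + L2_inner \<Omega> (\<lambda>x. src_s D (\<phi>0 x, symgrad \<Omega> u0 x, \<theta>0 x)) \<zeta>,
      0))"

context
  fixes \<Omega> :: "(real^'d) set" and D :: "'d model" and \<phi>0 :: "real^'d \<Rightarrow> real" and R :: real
  assumes op: "open \<Omega>" and bdd: "bounded \<Omega>"
    and A3: "assm_A3 D" and A4: "assm_A4 D" and A5: "assm_A5 D" and A6: "assm_A6 D"
    and \<phi>0: "\<phi>0 \<in> borel_measurable (lebesgue_on \<Omega>)" "\<And>x. x \<in> \<Omega> \<Longrightarrow> \<bar>\<phi>0 x\<bar> \<le> R"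
begin

lemma continuous_coefficients:
  "continuous_on UNIV (biot_M D)" "continuous_on UNIV (biot_alpha D)"
  "continuous_on UNIV (elast D)" "continuous_on UNIV (visc D)" "continuous_on UNIV (eigenstrain D)"
  using A3 A4 A6 by (auto simp: assm_A3_def assm_A4_def assm_A6_def elastic_tensor_def C2_bounded_def C2_funD(2))

lemma tensor_L2:
  assumes "G \<in> L2 \<Omega>"
  shows "(\<lambda>x. elast D (\<phi>0 x) (G x)) \<in> L2 \<Omega>" "(\<lambda>x. visc D (\<phi>0 x) (G x)) \<in> L2 \<Omega>"
  by (rule continuous_coefficients(3,4)[THEN L2_tensor, OF \<phi>0 assms], assumption)+

lemma biot_L2:
  fixes g :: "real^'d \<Rightarrow> 'b::euclidean_space"
  assumes "g \<in> L2 \<Omega>"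
  shows "(\<lambda>x. biot_M D (\<phi>0 x) *\<^sub>R g x) \<in> L2 \<Omega>" "(\<lambda>x. biot_alpha D (\<phi>0 x) *\<^sub>R g x) \<in> L2 \<Omega>"
  by (rule continuous_coefficients(1,2)[THEN L2_continuous_coeff, OF \<phi>0 assms], assumption)+

lemma pore_L2:
  assumes "G \<in> L2 \<Omega>" "\<theta> \<in> L2 \<Omega>"
  shows "(\<lambda>x. biot_M D (\<phi>0 x) * (\<theta> x - biot_alpha D (\<phi>0 x) * trace (G x))) \<in> L2 \<Omega>"
  using biot_L2(1)[OF L2_lincomb[OF assms(2) biot_L2(2)[OF L2_bounded_linear[OF linear_trace assms(1)]], of 1 "-1"]]
  by simp

lemma stress_lin_L2:
  assumes "G \<in> L2 \<Omega>" "\<theta> \<in> L2 \<Omega>"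
  shows "(\<lambda>x. stress_lin D (\<phi>0 x) (G x) (\<theta> x)) \<in> L2 \<Omega>"
proof -
  have "linear (\<lambda>y::real. y *\<^sub>R (mat 1 :: real^'d^'d))" by (rule linearI) (auto simp: scaleR_add_left)
  from L2_bounded_linear[OF this biot_L2(2)[OF pore_L2[OF assms]]]
  have 1: "(\<lambda>x. (biot_alpha D (\<phi>0 x) * (biot_M D (\<phi>0 x) * (\<theta> x - biot_alpha D (\<phi>0 x) * trace (G x))))
      *\<^sub>R (mat 1 :: real^'d^'d)) \<in> L2 \<Omega>"
    by simp
  show ?thesis
    using L2_lincomb[OF tensor_L2(1)[OF assms(1)] 1, of 2 "-1"]
    by (simp add: stress_lin_def mult_ac)
qed

lemma eigenstress_L2: "(\<lambda>x. elast D (\<phi>0 x) (eigenstrain D (\<phi>0 x))) \<in> L2 \<Omega>"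
proof -
  obtain B where B: "\<And>x. x \<in> \<Omega> \<Longrightarrow> norm (eigenstrain D (\<phi>0 x)) \<le> B"
    using bounded_comp[OF continuous_coefficients(5), of \<Omega> \<phi>0 R] \<phi>0(2) by blast
  have "(\<lambda>x. eigenstrain D (\<phi>0 x)) \<in> L2 \<Omega>"
    using lmeasurable_domain[OF op bdd] measurable_comp_continuous[OF continuous_coefficients(5) \<phi>0(1)] B
    by (rule L2_bounded)
  then show ?thesis by (rule tensor_L2(1))
qed

text \<open>The permeability is assumed measurable and bounded, not continuous, so it is treated
  apart from the other coefficients.\<close>

lemma perm_L2:
  fixes g :: "real^'d \<Rightarrow> 'b::euclidean_space"
  assumes "g \<in> L2 \<Omega>"
  shows "(\<lambda>x. perm D (\<phi>0 x) *\<^sub>R g x) \<in> L2 \<Omega>"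
proof -
  obtain k0 k1 where k: "0 < k0" "\<And>x. k0 \<le> perm D x" "\<And>x. perm D x \<le> k1"
    using A5 unfolding assm_A5_def by blast
  have "perm D \<in> borel_measurable borel" using A5 by (simp add: assm_A5_def)
  then have "(\<lambda>x. perm D (\<phi>0 x)) \<in> borel_measurable (lebesgue_on \<Omega>)" using \<phi>0(1) by measurable
  then show ?thesis
  proof (rule L2_scaleR_bounded[OF _ _ assms])
    show "\<bar>perm D (\<phi>0 x)\<bar> \<le> k1" for x using k(1) k(2,3)[of "\<phi>0 x"] by linarith
  qed
qed

text \<open>Each pairing is split into its share of the unknown and its share of the data;
  \<open>f1\<close> and the source term move to the load as a whole. The strain of the difference
  quotient splits only almost everywhere, which suffices under the integral.\<close>

lemma first_residual_eq:
  assumes u0: "u0 \<in> H1_vec \<Omega>" and \<theta>0: "\<theta>0 \<in> L2 \<Omega>"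
    and z: "u \<in> H1_vec \<Omega>" "\<theta> \<in> L2 \<Omega>" and w: "v \<in> H1_vec \<Omega>" "\<zeta> \<in> L2 \<Omega>"
  shows "first_residual \<Omega> D \<tau> f1 (\<phi>0, u0, \<theta>0) (u, \<theta>, p) (v, \<zeta>, q)
    = first_lin \<Omega> D \<tau> \<phi>0 (u, \<theta>, p) (v, \<zeta>, q) - first_load \<Omega> D \<tau> f1 (\<phi>0, u0, \<theta>0) (v, \<zeta>, q)"
proof -
  note E = symgrad_L2[OF z(1)] and E0 = symgrad_L2[OF u0] and Ev = symgrad_L2[OF w(1)]
  have d: "d_tau \<tau> u0 u = (\<lambda>x. (1/\<tau>) *\<^sub>R u x + (-1/\<tau>) *\<^sub>R u0 x)"
    by (simp add: d_tau_def scaleR_diff_right fun_eq_iff)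
  have Ed: "symgrad \<Omega> (d_tau \<tau> u0 u) \<in> L2 \<Omega>"
    unfolding d by (intro symgrad_L2 H1_vec_lincomb[OF op bdd] z u0)
  have "AE x in lebesgue_on \<Omega>. visc D (\<phi>0 x) (symgrad \<Omega> (d_tau \<tau> u0 u) x)
      = 1 *\<^sub>R visc D (\<phi>0 x) ((1/\<tau>) *\<^sub>R symgrad \<Omega> u x) + (-1) *\<^sub>R visc D (\<phi>0 x) ((1/\<tau>) *\<^sub>R symgrad \<Omega> u0 x)"
    using symgrad_lincomb[OF op bdd z(1) u0, of "1/\<tau>" "-1/\<tau>"] unfolding d
    by eventually_elim (simp add: blinfun.add_right blinfun.diff_right blinfun.scaleR_right blinfun.minus_right)
  note 1 = L2_inner_lincomb[OF tensor_L2(2)[OF L2_scaleR[OF E]] tensor_L2(2)[OF L2_scaleR[OF E0]] Ev tensor_L2(2)[OF Ed] this]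
  \<comment> \<open>Every value of \<open>symgrad\<close> is a symmetric matrix, so
    \<open>W_E_inner\<close> applies at each point of the integrand.\<close>
  have "L2_inner \<Omega> (\<lambda>x. W_E D (\<phi>0 x) (symgrad \<Omega> u x) (\<theta> x)) (symgrad \<Omega> v)
      = L2_inner \<Omega> (\<lambda>x. stress_lin D (\<phi>0 x) (symgrad \<Omega> u x) (\<theta> x) 
          - 2 *\<^sub>R elast D (\<phi>0 x) (eigenstrain D (\<phi>0 x))) (symgrad \<Omega> v)"
    unfolding L2_inner_def by (simp add: W_E_inner[OF A3] symgrad_symmetric)
  also have "\<dots> = 1 * L2_inner \<Omega> (\<lambda>x. stress_lin D (\<phi>0 x) (symgrad \<Omega> u x) (\<theta> x)) (symgrad \<Omega> v)
      + (-2) * L2_inner \<Omega> (\<lambda>x. elast D (\<phi>0 x) (eigenstrain D (\<phi>0 x))) (symgrad \<Omega> v)"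
    using L2_lincomb[OF stress_lin_L2[OF E z(2)] eigenstress_L2, of 1 "-2"]
    by (intro L2_inner_lincomb stress_lin_L2 E z(2) eigenstress_L2 Ev) auto
  finally have 2: "L2_inner \<Omega> (\<lambda>x. W_E D (\<phi>0 x) (symgrad \<Omega> u x) (\<theta> x)) (symgrad \<Omega> v) = \<dots>" .
  have 3: "L2_inner \<Omega> (\<lambda>x. visc D (\<phi>0 x) ((1/\<tau>) *\<^sub>R symgrad \<Omega> u x)
        + stress_lin D (\<phi>0 x) (symgrad \<Omega> u x) (\<theta> x)) (symgrad \<Omega> v)
      = 1 * L2_inner \<Omega> (\<lambda>x. visc D (\<phi>0 x) ((1/\<tau>) *\<^sub>R symgrad \<Omega> u x)) (symgrad \<Omega> v)
      + 1 * L2_inner \<Omega> (\<lambda>x. stress_lin D (\<phi>0 x) (symgrad \<Omega> u x) (\<theta> x)) (symgrad \<Omega> v)"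
    using L2_lincomb[OF tensor_L2(2)[OF L2_scaleR[OF E, of "1/\<tau>"]] stress_lin_L2[OF E z(2)], of 1 1]
    by (intro L2_inner_lincomb stress_lin_L2 tensor_L2(2) L2_scaleR E z(2) Ev) auto
  have 4: "L2_inner \<Omega> (d_tau \<tau> \<theta>0 \<theta>) \<zeta> = 1 * L2_inner \<Omega> (\<lambda>x. (1/\<tau>) * \<theta> x) \<zeta> + (-1) * L2_inner \<Omega> (\<lambda>x. (1/\<tau>) * \<theta>0 x) \<zeta>"
  proof (rule L2_inner_lincomb)
    show "d_tau \<tau> \<theta>0 \<theta> \<in> L2 \<Omega>"
      using L2_lincomb[OF z(2) \<theta>0, of "1/\<tau>" "-1/\<tau>"] by (simp add: d_tau_def diff_divide_distrib)
    show "AE x in lebesgue_on \<Omega>. d_tau \<tau> \<theta>0 \<theta> x = 1 *\<^sub>R (1/\<tau> * \<theta> x) + (-1) *\<^sub>R (1/\<tau> * \<theta>0 x)"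
      by (simp add: d_tau_def diff_divide_distrib)
    show "(\<lambda>x. 1/\<tau> * \<theta> x) \<in> L2 \<Omega>" "(\<lambda>x. 1/\<tau> * \<theta>0 x) \<in> L2 \<Omega>"
      using L2_scaleR[OF z(2), of "1/\<tau>"] L2_scaleR[OF \<theta>0, of "1/\<tau>"] by simp_all
  qed (rule w(2))
  show ?thesis
    by (simp add: first_residual_def first_lin_def first_load_def res_u_def res_theta_def res_p_def
        W_theta_eq 1 2 3 4)
qed

text \<open>The spaces reflect the derivatives that occur: \<theta> enters undifferentiated,
  \<open>p\<close> through its gradient, \<open>u\<close> through its symmetric gradient.\<close>

lemma first_lin_lincomb:
  assumes z: "u \<in> H1_vec \<Omega>" "\<theta> \<in> L2 \<Omega>" "p \<in> H1 \<Omega>" and z': "u' \<in> H1_vec \<Omega>" "\<theta>' \<in> L2 \<Omega>" "p' \<in> H1 \<Omega>"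
    and w: "v \<in> H1_vec \<Omega>" "\<zeta> \<in> H1 \<Omega>" "q \<in> L2 \<Omega>"
  shows "first_lin \<Omega> D \<tau> \<phi>0 (a *\<^sub>R (u, \<theta>, p) + c *\<^sub>R (u', \<theta>', p')) (v, \<zeta>, q)
    = a *\<^sub>R first_lin \<Omega> D \<tau> \<phi>0 (u, \<theta>, p) (v, \<zeta>, q) + c *\<^sub>R first_lin \<Omega> D \<tau> \<phi>0 (u', \<theta>', p') (v, \<zeta>, q)"
proof -
  note E = symgrad_L2[OF z(1)] and E' = symgrad_L2[OF z'(1)] and Ev = symgrad_L2[OF w(1)]
  let ?u = "\<lambda>x. a *\<^sub>R u x + c *\<^sub>R u' x" and ?\<theta> = "\<lambda>x. a * \<theta> x + c * \<theta>' x" and ?p = "\<lambda>x. a * p x + c * p' x"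
  have z'': "?u \<in> H1_vec \<Omega>" "?\<theta> \<in> L2 \<Omega>" "?p \<in> H1 \<Omega>"
    using H1_vec_lincomb[OF op bdd z(1) z'(1)] L2_lincomb[OF z(2) z'(2)] H1_lincomb[OF op bdd z(3) z'(3)]
    by simp_all
  note E'' = symgrad_L2[OF z''(1)]
  let ?S = "\<lambda>u \<theta> x. visc D (\<phi>0 x) ((1/\<tau>) *\<^sub>R symgrad \<Omega> u x) + stress_lin D (\<phi>0 x) (symgrad \<Omega> u x) (\<theta> x)"
  let ?Q = "\<lambda>u \<theta> x. biot_M D (\<phi>0 x) * (\<theta> x - biot_alpha D (\<phi>0 x) * trace (symgrad \<Omega> u x))"
  have S: "?S u \<theta> \<in> L2 \<Omega>" if "symgrad \<Omega> u \<in> L2 \<Omega>" "\<theta> \<in> L2 \<Omega>" for u \<theta>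
    using L2_lincomb[OF tensor_L2(2)[OF L2_scaleR[OF that(1), of "1/\<tau>"]] stress_lin_L2[OF that], of 1 1] by simp
  note lin = symgrad_lincomb[OF op bdd z(1) z'(1), of a c]
  have 1: "L2_inner \<Omega> (?S ?u ?\<theta>) (symgrad \<Omega> v) 
      = a * L2_inner \<Omega> (?S u \<theta>) (symgrad \<Omega> v) + c * L2_inner \<Omega> (?S u' \<theta>') (symgrad \<Omega> v)"
  proof (intro L2_inner_lincomb S E E' E'' Ev z z' z'')
    show "AE x in lebesgue_on \<Omega>. ?S ?u ?\<theta> x = a *\<^sub>R ?S u \<theta> x + c *\<^sub>R ?S u' \<theta>' x"
      using lin by eventually_elim 
        (simp add: stress_lin_lincomb blinfun.add_right blinfun.scaleR_right algebra_simps)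
  qed
  have 2: "L2_inner \<Omega> (\<lambda>x. (1/\<tau>) * ?\<theta> x) \<zeta> = a * L2_inner \<Omega> (\<lambda>x. (1/\<tau>) * \<theta> x) \<zeta> + c * L2_inner \<Omega> (\<lambda>x. (1/\<tau>) * \<theta>' x) \<zeta>"
  proof (rule L2_inner_lincomb)
    show "(\<lambda>x. 1/\<tau> * \<theta> x) \<in> L2 \<Omega>" "(\<lambda>x. 1/\<tau> * \<theta>' x) \<in> L2 \<Omega>" "(\<lambda>x. 1/\<tau> * ?\<theta> x) \<in> L2 \<Omega>"
      using L2_scaleR[OF z(2), of "1/\<tau>"] L2_scaleR[OF z'(2), of "1/\<tau>"] L2_scaleR[OF z''(2), of "1/\<tau>"]
      by simp_all
    show "AE x in lebesgue_on \<Omega>. 1/\<tau> * ?\<theta> x = a *\<^sub>R (1/\<tau> * \<theta> x) + c *\<^sub>R (1/\<tau> * \<theta>' x)"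
      by (simp add: add_divide_distrib)
  qed (use w H1_L2 in auto)
  have 3: "L2_inner \<Omega> (\<lambda>x. perm D (\<phi>0 x) *\<^sub>R grad \<Omega> ?p x) (grad \<Omega> \<zeta>)
      = a * L2_inner \<Omega> (\<lambda>x. perm D (\<phi>0 x) *\<^sub>R grad \<Omega> p x) (grad \<Omega> \<zeta>)
      + c * L2_inner \<Omega> (\<lambda>x. perm D (\<phi>0 x) *\<^sub>R grad \<Omega> p' x) (grad \<Omega> \<zeta>)"
  proof (intro L2_inner_lincomb perm_L2 grad_L2 z z' z'' w)
    show "AE x in lebesgue_on \<Omega>. perm D (\<phi>0 x) *\<^sub>R grad \<Omega> ?p x
        = a *\<^sub>R (perm D (\<phi>0 x) *\<^sub>R grad \<Omega> p x) + c *\<^sub>R (perm D (\<phi>0 x) *\<^sub>R grad \<Omega> p' x)"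
      using grad_lincomb[OF op bdd z(3) z'(3), of a c] 
      by eventually_elim (simp add: scaleR_add_right mult.commute)
  qed
  have 4: "L2_inner \<Omega> ?p q = a * L2_inner \<Omega> p q + c * L2_inner \<Omega> p' q"
    by (intro L2_inner_lincomb H1_L2 z z' z'' w) simp
  have 5: "L2_inner \<Omega> (?Q ?u ?\<theta>) q = a * L2_inner \<Omega> (?Q u \<theta>) q + c * L2_inner \<Omega> (?Q u' \<theta>') q"
  proof (intro L2_inner_lincomb pore_L2 E E' E'' z z' z'' w)
    show "AE x in lebesgue_on \<Omega>. ?Q ?u ?\<theta> x = a *\<^sub>R ?Q u \<theta> x + c *\<^sub>R ?Q u' \<theta>' x"
      using lin by eventually_elim (simp add: trace_lincomb algebra_simps)
  qed
  have "a *\<^sub>R (u, \<theta>, p) + c *\<^sub>R (u', \<theta>', p') = (?u, ?\<theta>, ?p)"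
    by (simp add: plus_fun_def scaleR_fun_def)
  then show ?thesis
    by (simp only: first_lin_def prod.case 1 2 3 4 5 scaleR_Pair add_Pair real_scaleR_def)
      (simp add: algebra_simps)
qed

end

lemma first_residual_linear_system:
  fixes D :: "'d::finite model"
  assumes op: "open \<Omega>" and bdd: "bounded \<Omega>"
    and A: "assm_A3 D" "assm_A4 D" "assm_A5 D" "assm_A6 D"
    and V: "\<phi>0 \<in> V_h \<Omega> \<T>" "u0 \<in> X_h_vec \<Omega> \<T>" "\<theta>0 \<in> V_h \<Omega> \<T>"
  shows "linear_system (first_space \<Omega> \<T>) (first_space \<Omega> \<T>) (first_residual \<Omega> D \<tau> f1 (\<phi>0, u0, \<theta>0))"
proof -
  obtain R where R: "\<And>x. x \<in> \<Omega> \<Longrightarrow> \<bar>\<phi>0 x\<bar> \<le> R" using V_h_bounded[OF op bdd V(1)] by blast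
  note c = op bdd A V_h_measurable[OF V(1)]
  note mem = X_h_vec_H1 V_h_L2 V_h_H1
  show ?thesis
    unfolding linear_system_def
  proof (intro exI[of _ "first_lin \<Omega> D \<tau> \<phi>0"] exI[of _ "first_load \<Omega> D \<tau> f1 (\<phi>0, u0, \<theta>0)"] conjI ballI allI)
    fix z w assume "z \<in> first_space \<Omega> \<T>" "w \<in> first_space \<Omega> \<T>"
    then show "first_residual \<Omega> D \<tau> f1 (\<phi>0, u0, \<theta>0) z w 
        = first_lin \<Omega> D \<tau> \<phi>0 z w - first_load \<Omega> D \<tau> f1 (\<phi>0, u0, \<theta>0) w"
      using V by (auto simp: first_space_def intro!: first_residual_eq[OF c] R mem)
  next
    fix z z' a b w assume "z \<in> first_space \<Omega> \<T>" "z' \<in> first_space \<Omega> \<T>" "w \<in> first_space \<Omega> \<T>"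
    then obtain u \<theta> p u' \<theta>' p' v \<zeta> q where eqs: "z = (u, \<theta>, p)" "z' = (u', \<theta>', p')" "w = (v, \<zeta>, q)"
      and m: "u \<in> X_h_vec \<Omega> \<T>" "u' \<in> X_h_vec \<Omega> \<T>" "v \<in> X_h_vec \<Omega> \<T>"
      "\<theta> \<in> V_h \<Omega> \<T>" "\<theta>' \<in> V_h \<Omega> \<T>" "\<zeta> \<in> V_h \<Omega> \<T>" "p \<in> V_h \<Omega> \<T>" "p' \<in> V_h \<Omega> \<T>" "q \<in> V_h \<Omega> \<T>"
      by (auto simp: first_space_def)
    show "first_lin \<Omega> D \<tau> \<phi>0 (a *\<^sub>R z + b *\<^sub>R z') w
        = a *\<^sub>R first_lin \<Omega> D \<tau> \<phi>0 z w + b *\<^sub>R first_lin \<Omega> D \<tau> \<phi>0 z' w"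
      unfolding eqs by (rule first_lin_lincomb[OF c]) (use m R mem in blast)+
  qed
qed

section \<open>The second step\<close>

text \<open>The \<open>\<phi>\<close>-derivative of the energy density, homogenised: with \<open>s = 1\<close> it is \<^const>\<open>W_phi\<close>,
  and it is homogeneous of degree two in \<open>(s, G)\<close>. Its quadratic growth in \<open>G\<close> thus follows from
  continuity on a compact set.\<close>

definition W_phi_hom :: "('d::finite) model \<Rightarrow> real \<Rightarrow> real \<Rightarrow> real^'d^'d \<Rightarrow> real \<Rightarrow> real" where
  "W_phi_hom D y s G \<theta> = (let X = G - s *\<^sub>R eigenstrain D y; T' = vderiv (eigenstrain D) y;
      z = s * \<theta> - biot_alpha D y * trace G in
    - s * (T' \<bullet> elast D y X) + X \<bullet> (vderiv (elast D) y X - s *\<^sub>R elast D y T')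
    + vderiv (biot_M D) y / 2 * z\<^sup>2 - biot_M D y * z * (vderiv (biot_alpha D) y * trace G))"

text \<open>For fixed \<theta> the quantities \<open>X\<close>, \<open>z\<close>, \<open>s\<close>
  and \<open>trace G\<close> are homogeneous of degree one in \<open>(s, G)\<close>, and every
  summand contains exactly two such factors.\<close>

lemma W_phi_hom_scale:
  "W_phi_hom D y (c * s) (c *\<^sub>R G) \<theta> = c\<^sup>2 * W_phi_hom D y s G \<theta>"
proof -
  define X where "X = G - s *\<^sub>R eigenstrain D y"
  have X: "c *\<^sub>R G - (c * s) *\<^sub>R eigenstrain D y = c *\<^sub>R X"
    by (simp add: X_def scaleR_diff_right)
  have z: "c * s * \<theta> - biot_alpha D y * trace (c *\<^sub>R G) = c * (s * \<theta> - biot_alpha D y * trace G)"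
    by (simp add: linear_cmul[OF linear_trace] algebra_simps)
  show ?thesis
    unfolding W_phi_hom_def Let_def X z X_def[symmetric]
    by (simp add: linear_cmul[OF linear_trace] blinfun.scaleR_right inner_diff_right power2_eq_square algebra_simps)
qed

lemma W_phi_eq:
  assumes A3: "assm_A3 D" and A6: "assm_A6 D"
  shows "W_phi D y G \<theta> = W_phi_hom D y 1 G \<theta>"
proof -
  have T: "(eigenstrain D has_vector_derivative vderiv (eigenstrain D) y) (at y)"
    and C: "(elast D has_vector_derivative vderiv (elast D) y) (at y)"
    using A3 by (auto simp: assm_A3_def elastic_tensor_def intro: C2_funD)
  have M: "(biot_M D has_real_derivative vderiv (biot_M D) y) (at y)"
    and \<alpha>: "(biot_alpha D has_real_derivative vderiv (biot_alpha D) y) (at y)"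
    using A6 by (auto simp: assm_A6_def C2_bounded_def has_real_derivative_iff_has_vector_derivative intro: C2_funD)
  have X: "((\<lambda>y. G - eigenstrain D y) has_vector_derivative - vderiv (eigenstrain D) y) (at y)"
    using has_vector_derivative_diff[OF has_vector_derivative_const T] by simp
  have "((\<lambda>y. (G - eigenstrain D y) \<bullet> elast D y (G - eigenstrain D y)) has_real_derivative
     (G - eigenstrain D y) \<bullet> (elast D y (- vderiv (eigenstrain D) y) + vderiv (elast D) y (G - eigenstrain D y))
     + (- vderiv (eigenstrain D) y) \<bullet> elast D y (G - eigenstrain D y)) (at y)"
    unfolding has_real_derivative_iff_has_vector_derivative
    by (intro bounded_bilinear.has_vector_derivative[OF bounded_bilinear_inner] X
      bounded_bilinear.has_vector_derivative[OF bounded_bilinear_blinfun_apply] C)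
  moreover have "((\<lambda>y. biot_M D y / 2 * (\<theta> - biot_alpha D y * trace G)\<^sup>2) has_real_derivative
     vderiv (biot_M D) y / 2 * (\<theta> - biot_alpha D y * trace G)\<^sup>2 
     - biot_M D y * (\<theta> - biot_alpha D y * trace G) * (vderiv (biot_alpha D) y * trace G)) (at y)"
    by (auto intro!: derivative_eq_intros M \<alpha> simp: power2_eq_square)
  ultimately have "((\<lambda>y. W_red D y G \<theta>) has_real_derivative W_phi_hom D y 1 G \<theta>) (at y)"
    unfolding W_red_def W_def
    by (rule DERIV_cong[OF DERIV_add])
      (simp add: W_phi_hom_def Let_def blinfun.minus_right inner_diff_right inner_add_right)
  then show ?thesis unfolding W_phi_def by (rule DERIV_imp_deriv)
qed

lemma continuous_W_phi_hom:
  fixes D :: "'d::finite model"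
  assumes A3: "assm_A3 D" and A6: "assm_A6 D"
    and f: "continuous_on S y" "continuous_on S s" "continuous_on S G" "continuous_on S \<theta>"
  shows "continuous_on S (\<lambda>x. W_phi_hom D (y x) (s x) (G x) (\<theta> x))"
proof -
  have c: "continuous_on UNIV (eigenstrain D)" "continuous_on UNIV (vderiv (eigenstrain D))"
    "continuous_on UNIV (elast D)" "continuous_on UNIV (vderiv (elast D))"
    "continuous_on UNIV (biot_M D)" "continuous_on UNIV (vderiv (biot_M D))"
    "continuous_on UNIV (biot_alpha D)" "continuous_on UNIV (vderiv (biot_alpha D))"
    using A3 A6 by (auto simp: assm_A3_def assm_A6_def elastic_tensor_def C2_bounded_def intro: C2_funD)
  have "continuous_on UNIV (trace :: real^'d^'d \<Rightarrow> real)"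
    by (intro linear_continuous_on linear_linear[THEN iffD2] linear_trace)
  note comp = c[THEN continuous_on_compose2, OF f(1) subset_UNIV]
    continuous_on_compose2[OF this f(3) subset_UNIV]
  show ?thesis
    unfolding W_phi_hom_def Let_def
    by (intro continuous_intros continuous_on_blinfun_at c(3,4) comp f) simp
qed

lemma W_phi_hom_bound:
  fixes D :: "'d::finite model"
  assumes "assm_A3 D" "assm_A6 D"
  obtains K where "\<And>y \<theta> G. \<bar>y\<bar> \<le> R \<Longrightarrow> \<bar>\<theta>\<bar> \<le> Q \<Longrightarrow> \<bar>W_phi_hom D y 1 G \<theta>\<bar> \<le> K * (1 + norm G)\<^sup>2"
proof -
  let ?f = "\<lambda>(y, s, G, \<theta>). W_phi_hom D y s G \<theta>"
  let ?S = "{-R..R} \<times> {0..1::real} \<times> cball (0::real^'d^'d) 1 \<times> {-Q..Q}"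
  have "compact (?f ` ?S)"
    unfolding split_def
    by (intro compact_continuous_image continuous_W_phi_hom assms continuous_intros compact_Times) auto
  then obtain K where K: "\<And>p. p \<in> ?S \<Longrightarrow> \<bar>?f p\<bar> \<le> K"
    using compact_imp_bounded by (fastforce simp: bounded_iff)
  show ?thesis
  proof (rule that)
    fix y \<theta> and G :: "real^'d^'d" assume *: "\<bar>y\<bar> \<le> R" "\<bar>\<theta>\<bar> \<le> Q"
    \<comment> \<open>Division by this \<open>c\<close> moves \<open>(1, G)\<close> into the product
      of [0,1] and the closed unit ball, and scaling back costs the factor c squared. The summand 1
      keeps \<open>c\<close> away from 0.\<close>
    define c where "c = 1 + norm G"
    have c: "c \<ge> 1" "norm G \<le> c" by (auto simp: c_def)
    have "W_phi_hom D y 1 G \<theta> = c\<^sup>2 * W_phi_hom D y (1/c) ((1/c) *\<^sub>R G) \<theta>"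
      using W_phi_hom_scale[of D y c "1/c" "(1/c) *\<^sub>R G" \<theta>] c by simp
    moreover have "\<bar>W_phi_hom D y (1/c) ((1/c) *\<^sub>R G) \<theta>\<bar> \<le> K"
      using K[of "(y, 1/c, (1/c) *\<^sub>R G, \<theta>)"] * c by (auto simp: abs_le_iff divide_simps)
    ultimately show "\<bar>W_phi_hom D y 1 G \<theta>\<bar> \<le> K * (1 + norm G)\<^sup>2"
      unfolding c_def[symmetric] by (simp add: abs_mult mult.commute[of K] mult_left_mono)
  qed
qed

lemma interp_bound:
  assumes "\<tau> > 0" "t \<in> interval \<tau> n" "\<bar>g0 x\<bar> \<le> R" "\<bar>g1 x\<bar> \<le> R"
  shows "\<bar>interp \<tau> n g0 g1 t x\<bar> \<le> (R::real)"
proof -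
  \<comment> \<open>The relative position in the time cell. It lies in [0,1], so the interpolant is
    a convex combination of the two values.\<close>
  define l where "l = (t - real n * \<tau>) / \<tau>"
  have l: "0 \<le> l" "l \<le> 1" using assms(1,2) by (auto simp: l_def interval_def field_simps)
  have "\<bar>(1 - l) * g0 x + l * g1 x\<bar> \<le> (1 - l) * R + l * R"
    using l assms(3,4)
    by (intro order_trans[OF abs_triangle_ineq] add_mono) (auto simp: abs_mult intro!: mult_left_mono)
  then show ?thesis unfolding interp_def l_def[symmetric] by (simp add: algebra_simps)
qed

text \<open>Quadratic growth in the square-integrable \<open>E\<close> puts the averaged derivative
  into L1 only, so it is paired with a bounded \<xi> instead of an L2 function. Its measurability in
  \<open>x\<close>, being that of a parameter integral, is obtained from joint measurability of the
  integrand in space and time.\<close>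

lemma integrable_W_phi_av:
  fixes D :: "'d::finite model" and \<Omega> :: "(real^'d) set"
  assumes A3: "assm_A3 D" and A6: "assm_A6 D" and \<tau>: "\<tau> > 0" and \<Omega>: "\<Omega> \<in> lmeasurable"
    and \<phi>0: "\<phi>0 \<in> borel_measurable (lebesgue_on \<Omega>)" "\<And>x. x \<in> \<Omega> \<Longrightarrow> \<bar>\<phi>0 x\<bar> \<le> R"
    and \<phi>1: "\<phi>1 \<in> borel_measurable (lebesgue_on \<Omega>)" "\<And>x. x \<in> \<Omega> \<Longrightarrow> \<bar>\<phi>1 x\<bar> \<le> R"
    and \<theta>: "\<theta> \<in> borel_measurable (lebesgue_on \<Omega>)" "\<And>x. x \<in> \<Omega> \<Longrightarrow> \<bar>\<theta> x\<bar> \<le> Q"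
    and \<xi>: "\<xi> \<in> borel_measurable (lebesgue_on \<Omega>)" "\<And>x. x \<in> \<Omega> \<Longrightarrow> \<bar>\<xi> x\<bar> \<le> P"
    and E: "E \<in> L2 \<Omega>"
  shows "integrable (lebesgue_on \<Omega>) (\<lambda>x. W_phi_av D \<tau> n \<phi>0 \<phi>1 E \<theta> x * \<xi> x)"
proof -
  let ?I = "interval \<tau> n" and ?L = "lebesgue_on \<Omega>"
  have I: "?I \<in> lmeasurable" unfolding interval_def by (rule lmeasurable_open) auto
  interpret I: finite_measure "lebesgue_on ?I" using I by (rule finite_measure_lebesgue_on)
  interpret L: finite_measure ?L using \<Omega> by (rule finite_measure_lebesgue_on)
  have mE: "E \<in> borel_measurable ?L" using E by (simp add: L2_def)
  obtain K where K: "\<And>y \<theta> G. \<bar>y\<bar> \<le> R \<Longrightarrow> \<bar>\<theta>\<bar> \<le> Q \<Longrightarrow> \<bar>W_phi_hom D y 1 G \<theta>\<bar> \<le> K * (1 + norm G)\<^sup>2"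
    using W_phi_hom_bound[OF A3 A6] by metis
  define w where "w x t = W_phi_hom D (interp \<tau> n \<phi>0 \<phi>1 t x) 1 (E x) (\<theta> x)" for x t
  \<comment> \<open>One continuous function of the old phase, new phase, strain, \<theta> and time;
    measurability of \<open>w\<close>, joint and in time alone, follows by composing it with
    measurable tuples.\<close>
  let ?h = "\<lambda>(a, b, G, \<theta>, t). W_phi_hom D (a + ((t - real n * \<tau>) / \<tau>) *\<^sub>R (b - a)) 1 G \<theta>"
  have h: "continuous_on UNIV ?h"
    unfolding split_def using \<tau> by (intro continuous_W_phi_hom A3 A6 continuous_intros) auto
  have id: "(\<lambda>t. t) \<in> borel_measurable (lebesgue_on ?I)"
    using I by (intro continuous_borel_measurable_lebesgue_on) auto
  have w: "case_prod w \<in> borel_measurable (?L \<Otimes>\<^sub>M lebesgue_on ?I)"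
  proof -
    have "(\<lambda>p. (\<phi>0 (fst p), \<phi>1 (fst p), E (fst p), \<theta> (fst p), snd p)) \<in> borel_measurable (?L \<Otimes>\<^sub>M lebesgue_on ?I)"
      by (intro borel_measurable_Pair measurable_compose[OF measurable_fst] measurable_compose[OF measurable_snd id]
          \<phi>0 \<phi>1 \<theta> mE)
    from borel_measurable_continuous_on[OF h this] show ?thesis
      by (simp add: w_def interp_def split_def)
  qed
  have wt: "w x \<in> borel_measurable (lebesgue_on ?I)" if "x \<in> \<Omega>" for x
  proof -
    have "(\<lambda>t. (\<phi>0 x, \<phi>1 x, E x, \<theta> x, t)) \<in> borel_measurable (lebesgue_on ?I)"
      by (intro borel_measurable_Pair id) auto
    from borel_measurable_continuous_on[OF h this] show ?thesis
      by (simp add: w_def[abs_def] interp_def)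
  qed
  define V where "V x = integral\<^sup>L (lebesgue_on ?I) (w x)" for x
  have V_meas: "V \<in> borel_measurable ?L"
    unfolding V_def using w by (rule I.borel_measurable_lebesgue_integral)
  define m where "m = measure (lebesgue_on ?I) (space (lebesgue_on ?I))"
  have V_bound: "\<bar>V x\<bar> \<le> m * (K * (1 + norm (E x))\<^sup>2)" if x: "x \<in> \<Omega>" for x
  proof -
    have b: "\<bar>w x t\<bar> \<le> K * (1 + norm (E x))\<^sup>2" if "t \<in> ?I" for t
      unfolding w_def using x that by (intro K interp_bound \<tau> \<phi>0 \<phi>1 \<theta>)
    have "norm (V x) \<le> integral\<^sup>L (lebesgue_on ?I) (\<lambda>t. K * (1 + norm (E x))\<^sup>2)"
      unfolding V_def
    proof (rule Bochner_Integration.integral_norm_bound_integral)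
      show "integrable (lebesgue_on ?I) (w x)"
        using b wt[OF x] by (intro I.integrable_const_bound[where B="K * (1 + norm (E x))\<^sup>2"] AE_I2) auto
    qed (use b in auto)
    then show ?thesis by (simp add: m_def)
  qed
  have "integrable ?L (\<lambda>x. V x * \<xi> x)"
  proof (rule Bochner_Integration.integrable_bound)
    \<comment> \<open>The bound uses (1 + e)^2 \<le> 2 + 2 e^2. Absolute values are taken because
      the hypotheses do not fix the signs of \<open>K\<close> and \<open>P\<close>.\<close>
    show "integrable ?L (\<lambda>x. m * \<bar>K\<bar> * \<bar>P\<bar> * (2 + 2 * (norm (E x))\<^sup>2))"
      using E by (auto simp: L2_def)
    show "(\<lambda>x. V x * \<xi> x) \<in> borel_measurable ?L" using V_meas \<xi>(1) by measurable
    have "\<bar>V x * \<xi> x\<bar> \<le> m * \<bar>K\<bar> * \<bar>P\<bar> * (2 + 2 * (norm (E x))\<^sup>2)" if x: "x \<in> \<Omega>" for x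
    proof -
      have m0: "0 \<le> m" by (simp add: m_def)
      have "\<bar>V x\<bar> \<le> m * (K * (1 + norm (E x))\<^sup>2)" using x by (rule V_bound)
      also have "\<dots> \<le> m * (\<bar>K\<bar> * (1 + norm (E x))\<^sup>2)"
        using m0 by (intro mult_left_mono mult_right_mono) auto
      also have "\<dots> = m * \<bar>K\<bar> * (1 + norm (E x))\<^sup>2" by (rule mult.assoc[symmetric])
      also have "\<dots> \<le> m * \<bar>K\<bar> * (2 + 2 * (norm (E x))\<^sup>2)"
        using sum_squares_bound[of 1 "norm (E x)"] m0 by (intro mult_left_mono) (auto simp: power2_sum)
      finally have "\<bar>V x\<bar> * \<bar>\<xi> x\<bar> \<le> (m * \<bar>K\<bar> * (2 + 2 * (norm (E x))\<^sup>2)) * \<bar>P\<bar>"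
        using \<xi>(2)[OF x] m0 by (intro mult_mono) auto
      then show ?thesis by (simp add: abs_mult mult_ac)
    qed
    then show "AE x in ?L. norm (V x * \<xi> x) \<le> norm (m * \<bar>K\<bar> * \<bar>P\<bar> * (2 + 2 * (norm (E x))\<^sup>2))"
      by (intro AE_I2) (fastforce intro: order_trans[OF _ abs_ge_self])
  qed
  then have "integrable ?L (\<lambda>x. (1/\<tau>) * (V x * \<xi> x))" by (rule integrable_mult_right)
  then show ?thesis
    by (simp add: W_phi_av_def W_phi_eq[OF A3 A6] V_def w_def[abs_def])
qed

section \<open>The potential, and the equivalence for one time step\<close>

lemma convex_deriv_mono:
  fixes f :: "real \<Rightarrow> real"
  assumes f: "convex_on UNIV f" and d: "\<And>x. f differentiable (at x)"
  shows "mono (deriv f)"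
proof (rule monoI)
  fix x y :: real assume "x \<le> y"
  have D: "(f has_real_derivative deriv f z) (at z)" for z
    using d by (simp add: DERIV_deriv_iff_real_differentiable)
  have tangent: "f b - f a \<ge> deriv f a * (b - a)" for a b
    by (rule convex_on_imp_above_tangent[OF f]) (use D in auto)
  \<comment> \<open>Adding the tangent inequalities at the two points cancels the values of
    \<open>f\<close> and leaves the monotonicity product.\<close>
  from tangent[where a=x and b=y] tangent[where a=y and b=x] 
  have "(deriv f y - deriv f x) * (y - x) \<ge> 0" by (simp add: algebra_simps)
  then show "deriv f x \<le> deriv f y"
    using \<open>x \<le> y\<close> by (cases "x = y") (auto simp: zero_le_mult_iff)
qed

text \<open>Monotonicity serves twice: it makes the derivative Borel measurable, although only its
  existence is assumed, and it bounds the derivative by its values at -R and R.\<close>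

lemma L2_deriv_convex:
  assumes f: "convex_on UNIV f" "\<And>x. f differentiable (at x)" and \<Omega>: "\<Omega> \<in> lmeasurable"
    and v: "v \<in> borel_measurable (lebesgue_on \<Omega>)" "\<And>x. x \<in> \<Omega> \<Longrightarrow> \<bar>v x\<bar> \<le> R"
  shows "(\<lambda>x. deriv f (v x)) \<in> L2 \<Omega>"
proof -
  have mono: "mono (deriv f)" using f by (rule convex_deriv_mono)
  have "(\<lambda>x. deriv f (v x)) \<in> borel_measurable (lebesgue_on \<Omega>)"
    using measurable_compose[OF v(1) borel_measurable_mono[OF mono]] .
  moreover have "norm (deriv f (v x)) \<le> \<bar>deriv f R\<bar> + \<bar>deriv f (-R)\<bar>" if "x \<in> \<Omega>" for x
  proof -
    have "- R \<le> v x" "v x \<le> R" using v(2)[OF that] by auto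
    then have "deriv f (- R) \<le> deriv f (v x)" "deriv f (v x) \<le> deriv f R"
      using mono by (auto dest: monoD)
    then show ?thesis by simp
  qed
  ultimately show ?thesis using \<Omega> by (intro L2_bounded)
qed

lemma L2_Psi_diff:
  assumes A2: "assm_A2 D" and \<Omega>: "\<Omega> \<in> lmeasurable"
    and \<phi>0: "\<phi>0 \<in> borel_measurable (lebesgue_on \<Omega>)" "\<And>x. x \<in> \<Omega> \<Longrightarrow> \<bar>\<phi>0 x\<bar> \<le> R"
    and \<phi>1: "\<phi>1 \<in> borel_measurable (lebesgue_on \<Omega>)" "\<And>x. x \<in> \<Omega> \<Longrightarrow> \<bar>\<phi>1 x\<bar> \<le> R"
  shows "(\<lambda>x. Psi_diff D (\<phi>1 x) (\<phi>0 x)) \<in> L2 \<Omega>"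
proof -
  \<comment> \<open>A change of sign reduces the concave part to the convex case.\<close>
  let ?g = "\<lambda>x. - Psi_cav D x"
  have cav: "convex_on UNIV ?g" "\<And>x. ?g differentiable (at x)" "\<And>x. Psi_cav D differentiable (at x)"
    and vex: "convex_on UNIV (Psi_vex D)" "\<And>x. Psi_vex D differentiable (at x)"
    using A2 by (auto simp: assm_A2_def concave_on_def intro!: differentiable_minus)
  have "deriv ?g = (\<lambda>x. - deriv (Psi_cav D) x)"
    using cav(3) by (auto simp: fun_eq_iff field_differentiable_def real_differentiable_def intro!: deriv_minus)
  then have "(\<lambda>x. - deriv (Psi_cav D) (\<phi>0 x)) \<in> L2 \<Omega>"
    using L2_deriv_convex[OF cav(1,2) \<Omega> \<phi>0] by simp
  from L2_lincomb[OF L2_deriv_convex[OF vex \<Omega> \<phi>1] this, of 1 "-1"] show ?thesis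
    by (simp add: Psi_diff_def)
qed

text \<open>(P) integrates the sum of the two terms, the second step subtracts two integrals. Since
  a non-integrable term would contribute the default value 0, additivity has to be earned by
  integrability of both.\<close>

lemma res_mu_split:
  fixes D :: "'d::finite model"
  assumes op: "open \<Omega>" and bdd: "bounded \<Omega>" and A: "assm_A2 D" "assm_A3 D" "assm_A6 D" and \<tau>: "\<tau> > 0"
    and V: "\<phi>0 \<in> V_h \<Omega> \<T>" "\<phi>1 \<in> V_h \<Omega> \<T>" "u1 \<in> X_h_vec \<Omega> \<T>" "\<theta>1 \<in> V_h \<Omega> \<T>" "\<xi> \<in> V_h \<Omega> \<T>"
  shows "res_mu \<Omega> D \<tau> n \<phi>0 \<phi>1 \<mu>1 u1 \<theta>1 \<xi> =
      L2_inner \<Omega> \<mu>1 \<xi> - gam D * L2_inner \<Omega> (grad \<Omega> \<phi>1) (grad \<Omega> \<xi>)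
      - L2_inner \<Omega> (\<lambda>x. Psi_diff D (\<phi>1 x) (\<phi>0 x)) \<xi>
      - L2_inner \<Omega> (W_phi_av D \<tau> n \<phi>0 \<phi>1 (symgrad \<Omega> u1) \<theta>1) \<xi>"
proof -
  note bd = V_h_bounded[OF op bdd]
  obtain R0 where R0: "\<And>x. x \<in> \<Omega> \<Longrightarrow> \<bar>\<phi>0 x\<bar> \<le> R0" using bd[OF V(1)] by blast
  obtain R1 where R1: "\<And>x. x \<in> \<Omega> \<Longrightarrow> \<bar>\<phi>1 x\<bar> \<le> R1" using bd[OF V(2)] by blast
  obtain Q where Q: "\<And>x. x \<in> \<Omega> \<Longrightarrow> \<bar>\<theta>1 x\<bar> \<le> Q" using bd[OF V(4)] by blast
  obtain P where P: "\<And>x. x \<in> \<Omega> \<Longrightarrow> \<bar>\<xi> x\<bar> \<le> P" using bd[OF V(5)] by blast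
  \<comment> \<open>\<open>interp_bound\<close> wants one bound for both time levels.\<close>
  have R: "\<bar>\<phi>0 x\<bar> \<le> max R0 R1" "\<bar>\<phi>1 x\<bar> \<le> max R0 R1" if "x \<in> \<Omega>" for x
    using R0[OF that] R1[OF that] by auto
  note m = V(1,2,4,5)[THEN V_h_measurable]
  note \<Omega> = lmeasurable_domain[OF op bdd]
  have 1: "integrable (lebesgue_on \<Omega>) (\<lambda>x. Psi_diff D (\<phi>1 x) (\<phi>0 x) \<bullet> \<xi> x)"
    by (rule integrable_L2_inner[OF L2_Psi_diff[OF A(1) \<Omega> m(1) R(1) m(2) R(2)] V_h_L2[OF V(5)]])
  have 2: "integrable (lebesgue_on \<Omega>) (\<lambda>x. W_phi_av D \<tau> n \<phi>0 \<phi>1 (symgrad \<Omega> u1) \<theta>1 x * \<xi> x)"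
    by (rule integrable_W_phi_av[OF A(2,3) \<tau> \<Omega> m(1) R(1) m(2) R(2) m(3) Q m(4) P 
        symgrad_L2[OF X_h_vec_H1[OF V(3)]]])
  show ?thesis
    using 1 2 by (simp add: res_mu_def L2_inner_def distrib_right)
qed

lemma P_step_iff_decoupled:
  fixes D :: "'d::finite model"
  assumes op: "open \<Omega>" and bdd: "bounded \<Omega>" and A: "assm_A2 D" "assm_A3 D" "assm_A6 D" and \<tau>: "\<tau> > 0"
    and V: "\<phi>0 \<in> V_h \<Omega> \<T>"
  shows "P_step \<Omega> \<T> D \<tau> n f1 (\<phi>0, u0, \<theta>0) (\<phi>1, \<mu>1, u1, \<theta>1, p1) \<longleftrightarrow>
    first_step \<Omega> \<T> D \<tau> f1 (\<phi>0, u0, \<theta>0) (u1, \<theta>1, p1) \<and>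
    second_step \<Omega> \<T> D \<tau> n \<phi>0 (u1, \<theta>1) (\<phi>1, \<mu>1)"
proof (cases "\<phi>1 \<in> V_h \<Omega> \<T> \<and> \<mu>1 \<in> V_h \<Omega> \<T> \<and> u1 \<in> X_h_vec \<Omega> \<T> \<and> \<theta>1 \<in> V_h \<Omega> \<T> \<and> p1 \<in> V_h \<Omega> \<T>")
  case True
  \<comment> \<open>If one test space were empty, the joint quantification in \<open>P_step\<close>
    would hold vacuously and say nothing about the other equations.\<close>
  have "(\<lambda>x. 0) \<in> V_h \<Omega> \<T>" "(\<lambda>x. 0) \<in> X_h_vec \<Omega> \<T>"
    using V_h_const[OF op bdd] X_h_vec_zero[OF op bdd] by auto
  then have ne: "V_h \<Omega> \<T> \<noteq> {}" "X_h_vec \<Omega> \<T> \<noteq> {}" by auto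
  have first: "first_step \<Omega> \<T> D \<tau> f1 (\<phi>0, u0, \<theta>0) (u1, \<theta>1, p1) \<longleftrightarrow>
      (\<forall>v\<in>X_h_vec \<Omega> \<T>. res_u \<Omega> D \<tau> f1 \<phi>0 u0 u1 \<theta>1 v = 0) \<and>
      (\<forall>\<zeta>\<in>V_h \<Omega> \<T>. res_theta \<Omega> D \<tau> \<phi>0 u0 \<theta>0 \<theta>1 p1 \<zeta> = 0) \<and>
      (\<forall>q\<in>V_h \<Omega> \<T>. res_p \<Omega> D \<phi>0 u1 \<theta>1 p1 q = 0)"
    using True ne unfolding first_step_def first_residual_def first_space_def by auto
  have second: "second_step \<Omega> \<T> D \<tau> n \<phi>0 (u1, \<theta>1) (\<phi>1, \<mu>1) \<longleftrightarrow>
      (\<forall>\<psi>\<in>V_h \<Omega> \<T>. res_phi \<Omega> D \<tau> \<phi>0 \<phi>1 \<mu>1 u1 \<theta>1 \<psi> = 0) \<and>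
      (\<forall>\<xi>\<in>V_h \<Omega> \<T>. res_mu \<Omega> D \<tau> n \<phi>0 \<phi>1 \<mu>1 u1 \<theta>1 \<xi> = 0)"
    using True ne unfolding second_step_def second_residual_def second_space_def
    by (auto simp: res_mu_split[OF op bdd A \<tau> V])
  show ?thesis
    using True ne unfolding first second P_step_def by auto
next
  case False
  then show ?thesis
    by (auto simp: P_step_def first_step_def second_step_def first_space_def second_space_def)
qed

section \<open>Nonlinearity of the second step\<close>

lemma C2_fun_power4: "C2_fun (\<lambda>x::real. x ^ 4)"
proof -
  have 1: "((\<lambda>x. x ^ 4) has_vector_derivative 4 * x ^ 3) (at x)" for x :: real
    unfolding has_real_derivative_iff_has_vector_derivative[symmetric]
    by (auto intro!: derivative_eq_intros)
  have 2: "((\<lambda>x. 4 * x ^ 3) has_vector_derivative 12 * x\<^sup>2) (at x)" for x :: real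
    unfolding has_real_derivative_iff_has_vector_derivative[symmetric]
    by (auto intro!: derivative_eq_intros)
  have d: "vderiv (\<lambda>x::real. x ^ 4) = (\<lambda>x. 4 * x ^ 3)"
    by (auto simp: vderiv_def intro!: ext vector_derivative_at 1)
  show ?thesis
    unfolding C2_fun_def C1_differentiable_on_def d
    by (intro conjI exI[of _ "\<lambda>x::real. 4 * x ^ 3"] exI[of _ "\<lambda>x::real. 12 * x\<^sup>2"] ballI 1 2 continuous_intros)
qed

lemma assm_A2_power4: "assm_A2 (D\<lparr>Psi := \<lambda>x. x ^ 4, Psi_vex := \<lambda>x. x ^ 4, Psi_cav := \<lambda>x. 0\<rparr>)"
proof -
  have "convex_on UNIV (\<lambda>x::real. x ^ 4)"
    by (rule convex_power_even) auto
  moreover have "bdd_below (range (\<lambda>x::real. x ^ 4))"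
    by (rule bdd_belowI[of _ 0]) auto
  moreover have "\<bar>x ^ 4\<bar> \<le> 1 * \<bar>x\<bar> powr 4 + 0" for x :: real
    by (cases "x = 0") (auto simp: powr_realpow[of _ 4, simplified] power_abs)
  then have "\<exists>q c1 c2. 0 \<le> q \<and> q \<le> 6 \<and> 0 \<le> c1 \<and> 0 \<le> c2 \<and> (\<forall>x::real. \<bar>x ^ 4\<bar> \<le> c1 * \<bar>x\<bar> powr q + c2)"
    by (intro exI[of _ 4] exI[of _ 1] exI[of _ 0]) auto
  ultimately show ?thesis
    using C2_fun_power4 by (simp add: assm_A2_def concave_on_def convex_on_const)
qed

lemma assm_A2_zero: "assm_A2 (D\<lparr>Psi := \<lambda>x. 0, Psi_vex := \<lambda>x. 0, Psi_cav := \<lambda>x. 0\<rparr>)"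
proof -
  have "vderiv (\<lambda>x. 0::real) = (\<lambda>x. 0)"
    by (auto simp: vderiv_def)
  then have "C2_fun (\<lambda>x. 0::real)"
    by (simp add: C2_fun_def)
  then show ?thesis
    by (auto simp: assm_A2_def concave_on_def convex_on_const intro!: exI[of _ "0::real"])
qed

text \<open>Subtracting two residuals cancels what they share, in particular the averaged energy
  derivative, which then never has to be evaluated.\<close>

lemma linear_system_diff:
  assumes "linear_system Z S Q" "linear_system Z S R"
  shows "linear_system Z S (\<lambda>z t. Q z t - R z t)"
proof -
  obtain A a where A: "\<forall>z\<in>Z. \<forall>t\<in>S. Q z t = A z t - a t"
      "\<forall>z\<in>Z. \<forall>z'\<in>Z. \<forall>c d. \<forall>t\<in>S. A (c *\<^sub>R z + d *\<^sub>R z') t = c *\<^sub>R A z t + d *\<^sub>R A z' t"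
    using assms(1) unfolding linear_system_def by (elim exE conjE)
  obtain B b where B: "\<forall>z\<in>Z. \<forall>t\<in>S. R z t = B z t - b t"
      "\<forall>z\<in>Z. \<forall>z'\<in>Z. \<forall>c d. \<forall>t\<in>S. B (c *\<^sub>R z + d *\<^sub>R z') t = c *\<^sub>R B z t + d *\<^sub>R B z' t"
    using assms(2) unfolding linear_system_def by (elim exE conjE)
  show ?thesis
    unfolding linear_system_def
    by (intro exI[of _ "\<lambda>z t. A z t - B z t"] exI[of _ "\<lambda>t. a t - b t"])
      (simp add: A B algebra_simps)
qed

text \<open>An affine map has vanishing second differences. Taking them at 0, z and 2z eliminates
  the unknown \<open>b\<close>.\<close>

lemma linear_system_second_difference:
  assumes "linear_system Z S R" and z: "0 \<in> Z" "z \<in> Z" "2 *\<^sub>R z \<in> Z" and t: "t \<in> S"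
  shows "R (2 *\<^sub>R z) t + R 0 t = 2 *\<^sub>R R z t"
proof -
  obtain A b where A: "\<forall>z\<in>Z. \<forall>t\<in>S. R z t = A z t - b t"
      "\<forall>z\<in>Z. \<forall>z'\<in>Z. \<forall>c d. \<forall>t\<in>S. A (c *\<^sub>R z + d *\<^sub>R z') t = c *\<^sub>R A z t + d *\<^sub>R A z' t"
    using assms(1) unfolding linear_system_def by (elim exE conjE)
  have "A 0 t = 0" using bspec[OF bspec[OF A(2) z(1)] z(1), THEN spec[of _ 0], THEN spec[of _ 0]] t by simp
  moreover have "A (2 *\<^sub>R z) t = 2 *\<^sub>R A z t" using bspec[OF bspec[OF A(2) z(2)] z(2), THEN spec[of _ 2], THEN spec[of _ 0]] t by simp
  ultimately show ?thesis
    using z t by (simp add: A(1) scaleR_2)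
qed

text \<open>If the residual with \<open>\<Psi> = 0\<close> is already nonlinear there is nothing to show; otherwise
  linearity for \<open>\<Psi>(x) = x\<^sup>4\<close> would pass to the difference of the two residuals, whose value at the
  constant \<open>\<phi>\<^sup>n\<^sup>+\<^sup>1 = c\<close> tested with \<open>1\<close> is \<open>-4 c\<^sup>3 |\<Omega>|\<close>.\<close>

lemma second_step_nonlinear:
  fixes D :: "'d::finite model"
  assumes op: "open \<Omega>" and bdd: "bounded \<Omega>" and ne: "\<Omega> \<noteq> {}"
  shows "\<exists>P Pvex Pcav. assm_A2 (D\<lparr>Psi := P, Psi_vex := Pvex, Psi_cav := Pcav\<rparr>) \<and>
     \<not> linear_system (second_space \<Omega> \<T>) (second_space \<Omega> \<T>)
       (second_residual \<Omega> (D\<lparr>Psi := P, Psi_vex := Pvex, Psi_cav := Pcav\<rparr>) \<tau> n \<phi>0 y)"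
proof -
  let ?D0 = "D\<lparr>Psi := \<lambda>x. 0, Psi_vex := \<lambda>x. 0, Psi_cav := \<lambda>x. 0\<rparr>"
  let ?D4 = "D\<lparr>Psi := \<lambda>x. x ^ 4, Psi_vex := \<lambda>x. x ^ 4, Psi_cav := \<lambda>x. 0\<rparr>"
  let ?Z = "second_space \<Omega> \<T>"
  let ?R = "\<lambda>D. second_residual \<Omega> D \<tau> n \<phi>0 y"
  have "\<not> (linear_system ?Z ?Z (?R ?D0) \<and> linear_system ?Z ?Z (?R ?D4))"
  proof
    assume "linear_system ?Z ?Z (?R ?D0) \<and> linear_system ?Z ?Z (?R ?D4)"
    then have lin: "linear_system ?Z ?Z (\<lambda>z t. ?R ?D4 z t - ?R ?D0 z t)"
      by (intro linear_system_diff) auto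
    obtain u1 \<theta>1 where y: "y = (u1, \<theta>1)" by (cases y)
    have d4: "deriv (\<lambda>x::real. x ^ 4) x = 4 * x ^ 3" for x
      by (rule DERIV_imp_deriv) (auto intro!: derivative_eq_intros)
    \<comment> \<open>The energy density does not contain the potential, so exchanging the potential
      leaves this term unchanged.\<close>
    have W: "W_phi_av ?D4 = W_phi_av D" "W_phi_av ?D0 = W_phi_av D"
      by (simp_all add: W_phi_av_def W_phi_def W_red_def W_def fun_eq_iff)
    \<comment> \<open>The test pair is 0 in the first equation and 1 in the second, so only the
      difference of the two potential terms survives.\<close>
    have val: "?R ?D4 (\<lambda>x. c, \<lambda>x. 0) (\<lambda>x. 0, \<lambda>x. 1) - ?R ?D0 (\<lambda>x. c, \<lambda>x. 0) (\<lambda>x. 0, \<lambda>x. 1) 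
        = (0, - 4 * c ^ 3 * measure lebesgue \<Omega>)" for c
      using op lmeasurable_domain[OF op bdd]
      by (simp add: y second_residual_def W res_phi_def L2_inner_def Psi_diff_def d4 measure_restrict_space)
    have Z: "(\<lambda>x. c, \<lambda>x. d) \<in> ?Z" for c d
      using V_h_const[OF op bdd] by (simp add: second_space_def)
    have "0 = (\<lambda>x::real^'d. 0::real, \<lambda>x::real^'d. 0::real)" 
      "2 *\<^sub>R (\<lambda>x::real^'d. 1::real, \<lambda>x::real^'d. 0::real) = (\<lambda>x. 2, \<lambda>x. 0)"
      by (simp_all add: zero_prod_def zero_fun_def scaleR_fun_def)
    note eqs = this
    \<comment> \<open>The second difference with c = 0, 1, 2 reads -32 |\<Omega>| = -8 |\<Omega>|. A
      nonempty open set has positive measure, whence the contradiction.\<close>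
    have "measure lebesgue \<Omega> = 0"
      using linear_system_second_difference[OF lin, of "(\<lambda>x. 1, \<lambda>x. 0)" "(\<lambda>x. 0, \<lambda>x. 1)", unfolded eqs val, OF Z Z Z Z]
      by simp
    moreover have "\<Omega> \<notin> null_sets lebesgue" 
      using op ne open_not_negligible by (auto simp: negligible_iff_null_sets)
    ultimately show False
      using lmeasurable_domain[OF op bdd] by (auto simp: measure_eq_0_null_sets null_sets_def fmeasurable_def measure_def enn2real_eq_0_iff)
  qed
  then show ?thesis using assm_A2_zero assm_A2_power4 by metis
qed

text \<open>A quadratic potential contributes only an affine term, so nonlinearity cannot be
  expected from the potential in every case; "in general" is therefore an existence claim over
  potentials, with all other data kept. The last conjunct carries the one-step equivalence over to
  whole trajectories.\<close>

theorem lemma3p1: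
  fixes \<Omega> :: "(real^'d) set" and \<T> :: "(real^'d) set set" and D :: "'d model"
    and T \<tau> :: real and nT :: nat
    and f :: "real \<Rightarrow> (real^'d \<Rightarrow> real^'d) \<Rightarrow> real"
    and fd :: "nat \<Rightarrow> (real^'d \<Rightarrow> real^'d) \<Rightarrow> real"
  assumes "assm_A0 \<Omega>" and "assm_A1 D" and "assm_A2 D" and "assm_A3 D"
    and "assm_A4 D" and "assm_A5 D" and "assm_A6 D" and "assm_A7 \<Omega> T D f"
    and "conforming_mesh \<Omega> \<T>"
    and "T > 0" and "\<tau> > 0" and "real nT = T / \<tau>"
    and "\<forall>n<nT. fd (Suc n) \<in> Hm1 \<Omega>"
  shows
    "(\<forall>n<nT. \<forall>\<phi>0\<in>V_h \<Omega> \<T>. \<forall>u0\<in>X_h_vec \<Omega> \<T>. \<forall>\<theta>0\<in>V_h \<Omega> \<T>.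
        (\<forall>\<phi>1 \<mu>1 u1 \<theta>1 p1.
           P_step \<Omega> \<T> D \<tau> n (fd (Suc n)) (\<phi>0, u0, \<theta>0) (\<phi>1, \<mu>1, u1, \<theta>1, p1) \<longleftrightarrow>
             first_step \<Omega> \<T> D \<tau> (fd (Suc n)) (\<phi>0, u0, \<theta>0) (u1, \<theta>1, p1) \<and>
             second_step \<Omega> \<T> D \<tau> n \<phi>0 (u1, \<theta>1) (\<phi>1, \<mu>1)) \<and>
        linear_system (first_space \<Omega> \<T>) (first_space \<Omega> \<T>)
          (first_residual \<Omega> D \<tau> (fd (Suc n)) (\<phi>0, u0, \<theta>0)) \<and>
        (\<forall>u1\<in>X_h_vec \<Omega> \<T>. \<forall>\<theta>1\<in>V_h \<Omega> \<T>. \<exists>P Pvex Pcav.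
           assm_A2 (D\<lparr>Psi := P, Psi_vex := Pvex, Psi_cav := Pcav\<rparr>) \<and>
           \<not> linear_system (second_space \<Omega> \<T>) (second_space \<Omega> \<T>)
               (second_residual \<Omega> (D\<lparr>Psi := P, Psi_vex := Pvex, Psi_cav := Pcav\<rparr>) \<tau> n \<phi>0 (u1, \<theta>1)))) \<and>
     (\<forall>\<phi>i\<in>V_h \<Omega> \<T>. \<forall>ui\<in>X_h_vec \<Omega> \<T>. \<forall>\<theta>i\<in>V_h \<Omega> \<T>. \<forall>\<phi> \<mu> u \<theta> p.
        solves_P \<Omega> \<T> D \<tau> nT fd (\<phi>i, ui, \<theta>i) (\<phi>, \<mu>, u, \<theta>, p) \<longleftrightarrow>
        solves_decoupled \<Omega> \<T> D \<tau> nT fd (\<phi>i, ui, \<theta>i) (\<phi>, \<mu>, u, \<theta>, p))"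
proof -
  have op: "open \<Omega>" and bdd: "bounded \<Omega>" and ne: "\<Omega> \<noteq> {}"
    using assms(1) by (auto simp: assm_A0_def bounded_lipschitz_domain_def)
  note step = P_step_iff_decoupled[OF op bdd assms(3,4,7,11)]
  have "solves_P \<Omega> \<T> D \<tau> nT fd init (\<phi>, \<mu>, u, \<theta>, p) \<longleftrightarrow> solves_decoupled \<Omega> \<T> D \<tau> nT fd init (\<phi>, \<mu>, u, \<theta>, p)"
    for init \<phi> \<mu> u \<theta> p
  proof (cases "P_admissible \<Omega> \<T> \<tau> nT init (\<phi>, \<mu>, u, \<theta>, p)")
    case True
    \<comment> \<open>The one-step equivalence needs a discrete old phase field. Membership in
      \<open>Pi1c\<close> provides it, as the grid point lies between 0 and the final time.\<close>
    have "\<phi> (real n * \<tau>) \<in> V_h \<Omega> \<T>" if "n < nT" for n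
      using True that assms(11) by (cases init) (auto simp: P_admissible_def Pi1c_def)
    then show ?thesis using True by (simp add: solves_P_def solves_decoupled_def step)
  qed (simp add: solves_P_def solves_decoupled_def)
  moreover note step second_step_nonlinear[OF op bdd ne] 
    first_residual_linear_system[OF op bdd assms(4-7)]
  ultimately show ?thesis by (intro conjI allI ballI impI)
qed

end
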